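(* The nested deduction Frege system $nd\mathscr{F}$ and the nested disjunction Frege system $no\mathscr{F}$ (both built over the same classical Frege system $\mathscr{F}$) linearly simulate one another: there is an algorithm transforming any $nd\mathscr{F}$ proof of a formula $A$ with $n$ steps into an $no\mathscr{F}$ proof of $A$ with $O(n)$ steps, and an algorithm transforming any $no\mathscr{F}$ proof of $A$ with $n$ steps into an $nd\mathscr{F}$ proof of $A$ with $O(n)$ steps.
   Context: Formulas of classical propositional logic are built from variables with $\wedge,\vee,\supset,\neg$. $\mathscr{F}$ is a fixed Frege system for classical propositional logic (finitely many axiom schemas, sole rule modus ponens; e.g. Kleene's system), containing the schema $(A\supset C)\supset((B\supset C)\supset((A\vee B)\supset C))$. Nested systems: a proof is a sequence of lines, each line being a formula together with its context, a finite sequence $\Gamma$ of currently open assumptions (initially empty). A line is available to a later line if its context is an initial subsequence of the later line's context and it lies in no assumption block that has already been closed. Allowed lines: (i) an instance of an axiom schema of $\mathscr{F}$ (context unchanged); (ii) opening an assumption $A$: the line $A$ with context $\Gamma*\langle A\rangle$, where $\Gamma$ is the context of the last available line; (iii) modus ponens from available lines $A$ and $A\supset B$, giving $B$ in the current context. In $nd\mathscr{F}$ one additionally has the nested deduction rule: if a block opened by assumption $A$ in context $\Gamma*\langle A\rangle$ ends with $B$, then one may close the block and write $A\supset B$ in context $\Gamma$; the lines of the closed block become unavailable. In $no\mathscr{F}$ one instead has the nested disjunction elimination rule $\vee_{ne}$: if $A\vee B$ is available in context $\Gamma$, a block opened by assumption $A$ (context $\Gamma*\langle A\rangle$) ends with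 $C$, and a subsequent block opened by assumption $B$ (context $\Gamma*\langle B\rangle$) ends with $C$, one may close both blocks and write $C$ in context $\Gamma$; lines of the closed blocks become unavailable. A proof of $A$ is such a sequence whose last line is $A$ with empty context; the number of steps is the number of lines. *)

theory Defs
  imports Main "HOL-Library.Sublist" "HOL-Library.Nat_Bijection"
begin

section \<open>Classical propositional formulas\<close>

datatype form =
    Var nat
  | And form form
  | Or form form
  | Imp form form
  | Neg form

primrec holds :: "(nat \<Rightarrow> bool) \<Rightarrow> form \<Rightarrow> bool" where
  "holds v (Var n) \<longleftrightarrow> v n"
| "holds v (And A B) \<longleftrightarrow> holds v A \<and> holds v B"
| "holds v (Or A B) \<longleftrightarrow> holds v A \<or> holds v B"
| "holds v (Imp A B) \<longleftrightarrow> (holds v A \<longrightarrow> holds v B)"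
| "holds v (Neg A) \<longleftrightarrow> \<not> holds v A"

definition tautology :: "form \<Rightarrow> bool" where
  "tautology A \<longleftrightarrow> (\<forall>v. holds v A)"

primrec subst :: "(nat \<Rightarrow> form) \<Rightarrow> form \<Rightarrow> form" where
  "subst \<sigma> (Var n) = \<sigma> n"
| "subst \<sigma> (And A B) = And (subst \<sigma> A) (subst \<sigma> B)"
| "subst \<sigma> (Or A B) = Or (subst \<sigma> A) (subst \<sigma> B)"
| "subst \<sigma> (Imp A B) = Imp (subst \<sigma> A) (subst \<sigma> B)"
| "subst \<sigma> (Neg A) = Neg (subst \<sigma> A)"

section \<open>Frege systems\<close>

text \<open>
  An axiom schema is a formula whose variables play the role of metavariables; its instances are
  its substitution instances. Modus ponens being the only rule, a Frege system is given by its
  set of axiom schemas.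
\<close>

definition axiom_instance :: "form set \<Rightarrow> form \<Rightarrow> bool" where
  "axiom_instance F A \<longleftrightarrow> (\<exists>S \<in> F. \<exists>\<sigma>. A = subst \<sigma> S)"

inductive frege_provable :: "form set \<Rightarrow> form \<Rightarrow> bool" for F where
  ax: "axiom_instance F A \<Longrightarrow> frege_provable F A"
| mp: "frege_provable F A \<Longrightarrow> frege_provable F (Imp A B) \<Longrightarrow> frege_provable F B"

definition or_elim_schema :: "form \<Rightarrow> form \<Rightarrow> form \<Rightarrow> form" where
  "or_elim_schema A B C = Imp (Imp A C) (Imp (Imp B C) (Imp (Or A B) C))"

text \<open>The last conjunct is membership of the schema up to the choice of its metavariables.\<close>

definition classical_frege_system :: "form set \<Rightarrow> bool" where
  "classical_frege_system F \<longleftrightarrow>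
     finite F \<and>
     (\<forall>A. frege_provable F A \<longleftrightarrow> tautology A) \<and>
     (\<exists>a b c. distinct [a, b, c] \<and> or_elim_schema (Var a) (Var b) (Var c) \<in> F)"

section \<open>Nested systems\<close>

type_synonym ctx = "form list"
type_synonym line = "ctx \<times> form"

definition current_ctx :: "line list \<Rightarrow> ctx" where
  "current_ctx P = (if P = [] then [] else fst (last P))"

text \<open>\<open>U\<close> is the set of positions of the lines that lie in a closed assumption block.\<close>

definition available :: "line list \<Rightarrow> nat set \<Rightarrow> ctx \<Rightarrow> form \<Rightarrow> bool" where
  "available P U \<Gamma> A \<longleftrightarrow>
     (\<exists>i < length P. i \<notin> U \<and> prefix (fst (P ! i)) \<Gamma> \<and> snd (P ! i) = A)"

text \<open>
  \<open>nd_lines F P S U\<close>: the lines \<open>P\<close> have been written correctly; \<open>S\<close> lists the positions at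
  which the currently open blocks start (innermost first), and \<open>U\<close> is as above.
\<close>

inductive nd_lines :: "form set \<Rightarrow> line list \<Rightarrow> nat list \<Rightarrow> nat set \<Rightarrow> bool" for F where
  nd_empty: "nd_lines F [] [] {}"
| nd_axiom: "\<lbrakk>nd_lines F P S U; axiom_instance F A\<rbrakk>
    \<Longrightarrow> nd_lines F (P @ [(current_ctx P, A)]) S U"
| nd_assume: "nd_lines F P S U
    \<Longrightarrow> nd_lines F (P @ [(current_ctx P @ [A], A)]) (length P # S) U"
| nd_mp: "\<lbrakk>nd_lines F P S U;
      available P U (current_ctx P) A; available P U (current_ctx P) (Imp A B)\<rbrakk>
    \<Longrightarrow> nd_lines F (P @ [(current_ctx P, B)]) S U"
| nd_deduction: "\<lbrakk>nd_lines F P (i # S) U;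
      P ! i = (\<Gamma> @ [A], A); last P = (\<Gamma> @ [A], B)\<rbrakk>
    \<Longrightarrow> nd_lines F (P @ [(\<Gamma>, Imp A B)]) S (U \<union> {i..<length P})"

definition nd_proof :: "form set \<Rightarrow> line list \<Rightarrow> form \<Rightarrow> bool" where
  "nd_proof F P A \<longleftrightarrow> (\<exists>S U. nd_lines F P S U) \<and> P \<noteq> [] \<and> last P = ([], A)"

text \<open>
  In the nested disjunction system a block is either the first block of a pair, starting at
  position \<open>i\<close> (\<open>First i\<close>), or the second one, starting at position \<open>k\<close>, the first one having
  occupied positions \<open>i, \<dots>, k - 1\<close> (\<open>Second i k\<close>). As the context of the second block
  is \<open>\<Gamma> * \<langle>B\<rangle>\<close> and not \<open>\<Gamma> * \<langle>A\<rangle> * \<langle>B\<rangle>\<close>, the first block is left, and its lines become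
  unavailable, when the second one is opened. This is recorded explicitly because it cannot be
  read off the contexts if \<open>A = B\<close>.
\<close>

datatype block = First nat | Second nat nat

inductive no_lines :: "form set \<Rightarrow> line list \<Rightarrow> block list \<Rightarrow> nat set \<Rightarrow> bool" for F where
  no_empty: "no_lines F [] [] {}"
| no_axiom: "\<lbrakk>no_lines F P S U; axiom_instance F A\<rbrakk>
    \<Longrightarrow> no_lines F (P @ [(current_ctx P, A)]) S U"
| no_assume: "no_lines F P S U
    \<Longrightarrow> no_lines F (P @ [(current_ctx P @ [A], A)]) (First (length P) # S) U"
| no_assume_second: "\<lbrakk>no_lines F P (First i # S) U; current_ctx P = \<Gamma> @ [A]\<rbrakk>
    \<Longrightarrow> no_lines F (P @ [(\<Gamma> @ [B], B)]) (Second i (length P) # S) (U \<union> {i..<length P})"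
| no_mp: "\<lbrakk>no_lines F P S U;
      available P U (current_ctx P) A; available P U (current_ctx P) (Imp A B)\<rbrakk>
    \<Longrightarrow> no_lines F (P @ [(current_ctx P, B)]) S U"
| no_or_elim: "\<lbrakk>no_lines F P (Second i k # S) U; available P U \<Gamma> (Or A B);
      P ! i = (\<Gamma> @ [A], A); P ! (k - 1) = (\<Gamma> @ [A], C);
      P ! k = (\<Gamma> @ [B], B); last P = (\<Gamma> @ [B], C)\<rbrakk>
    \<Longrightarrow> no_lines F (P @ [(\<Gamma>, C)]) S (U \<union> {k..<length P})"

definition no_proof :: "form set \<Rightarrow> line list \<Rightarrow> form \<Rightarrow> bool" where
  "no_proof F P A \<longleftrightarrow> (\<exists>S U. no_lines F P S U) \<and> P \<noteq> [] \<and> last P = ([], A)"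

section \<open>Algorithms\<close>

text \<open>
  Partial recursive functions on the natural numbers, in unary form: several arguments are
  passed through the pairing function \<open>prod_encode\<close>.
\<close>

inductive partial_recursive :: "(nat \<Rightarrow> nat option) \<Rightarrow> bool" where
  pr_zero: "partial_recursive (\<lambda>n. Some 0)"
| pr_suc: "partial_recursive (\<lambda>n. Some (Suc n))"
| pr_fst: "partial_recursive (\<lambda>n. Some (fst (prod_decode n)))"
| pr_snd: "partial_recursive (\<lambda>n. Some (snd (prod_decode n)))"
| pr_pair: "\<lbrakk>partial_recursive f; partial_recursive g\<rbrakk>
    \<Longrightarrow> partial_recursive
          (\<lambda>n. Option.bind (f n) (\<lambda>x. Option.bind (g n) (\<lambda>y. Some (prod_encode (x, y)))))"
| pr_comp: "\<lbrakk>partial_recursive f; partial_recursive g\<rbrakk>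
    \<Longrightarrow> partial_recursive (\<lambda>n. Option.bind (g n) f)"
| pr_rec: "\<lbrakk>partial_recursive f; partial_recursive g\<rbrakk>
    \<Longrightarrow> partial_recursive
          (\<lambda>n. rec_nat (f (fst (prod_decode n)))
                 (\<lambda>k r. Option.bind r
                    (\<lambda>y. g (prod_encode (fst (prod_decode n), prod_encode (k, y)))))
                 (snd (prod_decode n)))"
| pr_mu: "partial_recursive f
    \<Longrightarrow> partial_recursive
          (\<lambda>n. if \<exists>m. f (prod_encode (n, m)) = Some 0 \<and>
                      (\<forall>k<m. f (prod_encode (n, k)) \<noteq> None)
               then Some (LEAST m. f (prod_encode (n, m)) = Some 0)
               else None)"

primrec form_encode :: "form \<Rightarrow> nat" where
  "form_encode (Var n) = prod_encode (0, n)"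
| "form_encode (And A B) = prod_encode (1, prod_encode (form_encode A, form_encode B))"
| "form_encode (Or A B) = prod_encode (2, prod_encode (form_encode A, form_encode B))"
| "form_encode (Imp A B) = prod_encode (3, prod_encode (form_encode A, form_encode B))"
| "form_encode (Neg A) = prod_encode (4, form_encode A)"

definition line_encode :: "line \<Rightarrow> nat" where
  "line_encode l = prod_encode (list_encode (map form_encode (fst l)), form_encode (snd l))"

definition proof_encode :: "line list \<Rightarrow> nat" where
  "proof_encode P = list_encode (map line_encode P)"

text \<open>
  \<open>linearly_simulates Q_proof P_proof\<close>: some algorithm turns each proof in the second system
  into a proof in the first system of the same formula, with linear growth of the number of steps.
\<close>

definition linearly_simulates ::
  "(line list \<Rightarrow> form \<Rightarrow> bool) \<Rightarrow> (line list \<Rightarrow> form \<Rightarrow> bool) \<Rightarrow> bool" where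
  "linearly_simulates Q_proof P_proof \<longleftrightarrow>
     (\<exists>f c. partial_recursive f \<and>
        (\<forall>P A. P_proof P A \<longrightarrow>
           (\<exists>Q. f (proof_encode P) = Some (proof_encode Q) \<and>
                Q_proof Q A \<and> length Q \<le> c * length P)))"

end

theory Submission imports Defs begin

text \<open>
  In one direction, a block deriving \<open>B\<close> from \<open>A\<close> is replaced by an elimination of the
  disjunction \<open>A \<or> \<not> A\<close>, proved just before the block, with conclusion \<open>A \<supset> B\<close> in both cases.
  In the other, the two blocks of a disjunction elimination are closed by the deduction rule,
  giving \<open>A \<supset> C\<close> and \<open>B \<supset> C\<close>, from which \<open>C\<close> follows by the disjunction schema. All the
  auxiliary derivations are instances of fixed ones, so each line costs boundedly many lines.
  As closing a block restores the formulas that were available when it was opened, it suffices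
  that, in each open block, the translated proof has at least the formulas of the given one
  available.
  The rule that produced a line can be read off its context and that of the previous line, except
  for axioms and modus ponens, which are copied, and for a second assumption equal to the first.
  Hence both translations are computed by a single pass over the proof.
\<close>

section \<open>Computable functions on encoded data\<close>

definition total_recursive :: "(nat \<Rightarrow> nat) \<Rightarrow> bool" where
  "total_recursive f \<longleftrightarrow> partial_recursive (\<lambda>n. Some (f n))"

lemma total_recursive_zero: "total_recursive (\<lambda>n. 0)"
  unfolding total_recursive_def by (rule pr_zero)

lemma total_recursive_Suc: "total_recursive Suc"
  unfolding total_recursive_def by (rule pr_suc)

lemma total_recursive_fst: "total_recursive (\<lambda>n. fst (prod_decode n))"
  unfolding total_recursive_def by (rule pr_fst)

lemma total_recursive_snd: "total_recursive (\<lambda>n. snd (prod_decode n))"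
  unfolding total_recursive_def by (rule pr_snd)

lemma total_recursive_pair:
  assumes "total_recursive f" "total_recursive g"
  shows "total_recursive (\<lambda>n. prod_encode (f n, g n))"
  using pr_pair[OF assms[unfolded total_recursive_def]] by (simp add: total_recursive_def)

lemma total_recursive_comp:
  assumes "total_recursive f" "total_recursive g"
  shows "total_recursive (\<lambda>n. f (g n))"
  using pr_comp[OF assms[unfolded total_recursive_def]] by (simp add: total_recursive_def)

lemma total_recursive_const: "total_recursive (\<lambda>n. c)"
  by (induction c)
    (auto intro: total_recursive_zero total_recursive_comp[OF total_recursive_Suc])

lemma total_recursive_ident: "total_recursive (\<lambda>n. n)"
  using total_recursive_pair[OF total_recursive_fst total_recursive_snd] by simp

lemma total_recursive_rec_nat:
  assumes "total_recursive f" "total_recursive g" "total_recursive m"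
  shows "total_recursive
    (\<lambda>n. rec_nat (f n) (\<lambda>k y. g (prod_encode (n, prod_encode (k, y)))) (m n))"
proof -
  have "rec_nat (Some a) (\<lambda>k r. Option.bind r (\<lambda>y. Some (h k y))) n
      = Some (rec_nat a h n)" for a :: nat and h n
    by (induction n) auto
  then have "total_recursive
    (\<lambda>p. rec_nat (f (fst (prod_decode p)))
           (\<lambda>k y. g (prod_encode (fst (prod_decode p), prod_encode (k, y))))
           (snd (prod_decode p)))"
    using pr_rec[OF assms(1,2)[unfolded total_recursive_def]] by (simp add: total_recursive_def)
  from total_recursive_comp[OF this total_recursive_pair[OF total_recursive_ident assms(3)]]
  show ?thesis by simp
qed

class encodable =
  fixes enc :: "'a \<Rightarrow> nat"
  assumes enc_inject: "enc x = enc y \<longleftrightarrow> x = y"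

instantiation nat :: encodable
begin
definition enc_nat :: "nat \<Rightarrow> nat" where "enc_nat n = n"
instance by standard (simp add: enc_nat_def)
end

instantiation prod :: (encodable, encodable) encodable
begin
definition enc_prod :: "'a \<times> 'b \<Rightarrow> nat" where
  "enc_prod p = prod_encode (enc (fst p), enc (snd p))"
instance by standard (auto simp: enc_prod_def enc_inject prod_eq_iff)
end

instantiation list :: (encodable) encodable
begin
definition enc_list :: "'a list \<Rightarrow> nat" where
  "enc_list xs = list_encode (map enc xs)"
instance
  by standard (simp add: enc_list_def list_encode_eq inj_map_eq_map inj_on_def enc_inject)
end

lemma form_encode_inject: "form_encode A = form_encode B \<longleftrightarrow> A = B"
proof (induction A arbitrary: B)
  case (Var n) then show ?case by (cases B) auto
next
  case (And A1 A2) then show ?case by (cases B) auto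
next
  case (Or A1 A2) then show ?case by (cases B) auto
next
  case (Imp A1 A2) then show ?case by (cases B) auto
next
  case (Neg A) then show ?case by (cases B) auto
qed

instantiation form :: encodable
begin
definition enc_form :: "form \<Rightarrow> nat" where "enc_form = form_encode"
instance by standard (simp add: enc_form_def form_encode_inject)
end

lemma enc_Nil: "enc [] = 0"
  by (simp add: enc_list_def)

lemma enc_Cons: "enc (x # xs) = Suc (prod_encode (enc x, enc xs))"
  by (simp add: enc_list_def)

lemma length_le_enc: "length xs \<le> enc xs"
proof (induction xs)
  case (Cons x xs)
  then show ?case using le_prod_encode_2[of "enc xs" "enc x"] by (simp add: enc_Cons)
qed simp

lemma enc_eq_proof_encode: "enc = proof_encode"
  by (rule ext)
    (simp add: proof_encode_def line_encode_def enc_list_def enc_prod_def enc_form_def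
      cong: map_cong)

definition computable :: "('a::encodable \<Rightarrow> 'b::encodable) \<Rightarrow> bool" where
  "computable f \<longleftrightarrow> (\<exists>g. total_recursive g \<and> (\<forall>x. g (enc x) = enc (f x)))"

lemma computableI: "total_recursive g \<Longrightarrow> (\<And>x. g (enc x) = enc (f x)) \<Longrightarrow> computable f"
  unfolding computable_def by blast

lemma computableE:
  assumes "computable f"
  obtains g where "total_recursive g" "\<And>x. g (enc x) = enc (f x)"
  using assms unfolding computable_def by blast

lemma computable_const: "computable (\<lambda>x. c)"
  by (rule computableI[OF total_recursive_const]) simp

lemma computable_ident: "computable (\<lambda>x. x)"
  by (rule computableI[OF total_recursive_ident]) simp

lemma computable_enc: "computable f \<Longrightarrow> computable (\<lambda>x. enc (f x))"
  unfolding computable_def enc_nat_def .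

lemma computable_comp:
  assumes "computable f" "computable g"
  shows "computable (\<lambda>x. f (g x))"
  using assms unfolding computable_def
  by (metis (mono_tags, lifting) total_recursive_comp)

lemma computable_Pair:
  assumes "computable f" "computable g"
  shows "computable (\<lambda>x. (f x, g x))"
proof -
  obtain f' g' where "total_recursive f'" "\<And>x. f' (enc x) = enc (f x)"
    "total_recursive g'" "\<And>x. g' (enc x) = enc (g x)"
    using assms by (meson computableE)
  then show ?thesis
    by (intro computableI[OF total_recursive_pair[of f' g']]) (auto simp: enc_prod_def)
qed

lemma computable_comp2:
  assumes "computable (\<lambda>p. h (fst p) (snd p))" "computable f" "computable g"
  shows "computable (\<lambda>x. h (f x) (g x))"
  using computable_comp[OF assms(1) computable_Pair[OF assms(2,3)]] by simp

lemma computable_fst: "computable f \<Longrightarrow> computable (\<lambda>x. fst (f x))"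
  by (rule computable_comp[of fst], rule computableI[OF total_recursive_fst])
    (simp_all add: enc_prod_def)

lemma computable_snd: "computable f \<Longrightarrow> computable (\<lambda>x. snd (f x))"
  by (rule computable_comp[of snd], rule computableI[OF total_recursive_snd])
    (simp_all add: enc_prod_def)

lemma computable_rec_nat:
  assumes "computable f" "computable (\<lambda>p. g (fst p) (fst (snd p)) (snd (snd p)))" "computable m"
  shows "computable (\<lambda>x. rec_nat (f x) (g x) (m x))"
proof -
  obtain f' g' m' where f': "total_recursive f'" "\<And>x. f' (enc x) = enc (f x)"
    and g': "total_recursive g'"
      "\<And>p. g' (enc p) = enc (g (fst p) (fst (snd p)) (snd (snd p)))"
    and m': "total_recursive m'" "\<And>x. m' (enc x) = enc (m x)"
    using assms by (meson computableE)
  have "g' (prod_encode (enc x, prod_encode (k, enc y))) = enc (g x k y)" for x k y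
    using g'(2)[of "(x, k, y)"] by (simp add: enc_prod_def enc_nat_def)
  then have "rec_nat (f' (enc x)) (\<lambda>k y. g' (prod_encode (enc x, prod_encode (k, y)))) n
      = enc (rec_nat (f x) (g x) n)" for x n
    by (induction n) (auto simp: f'(2))
  then show ?thesis
    by (intro computableI[OF total_recursive_rec_nat[OF f'(1) g'(1) m'(1)]])
      (simp add: m'(2) enc_nat_def)
qed

lemma computable_case_nat:
  assumes "computable m" "computable f" "computable (\<lambda>p. g (fst p) (snd p))"
  shows "computable (\<lambda>x. case m x of 0 \<Rightarrow> f x | Suc k \<Rightarrow> g x k)"
proof -
  have "rec_nat (f x) (\<lambda>k _. g x k) n = (case n of 0 \<Rightarrow> f x | Suc k \<Rightarrow> g x k)" for x n
    by (cases n) auto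
  moreover have "computable (\<lambda>p. g (fst p) (fst (snd p)))"
    by (intro computable_comp2[OF assms(3)] computable_fst computable_snd computable_ident)
  ultimately show ?thesis
    using computable_rec_nat[of f "\<lambda>x k _. g x k" m] assms(1,2) by simp
qed

lemma computable_funpow:
  fixes g :: "'a::encodable \<Rightarrow> 'a"
  assumes "computable g" "computable m" "computable f"
  shows "computable (\<lambda>x. (g ^^ m x) (f x))"
proof -
  have "rec_nat a (\<lambda>_. g) n = (g ^^ n) a" for a n
    by (induction n) auto
  then show ?thesis
    using computable_rec_nat[of f "\<lambda>_ _. g" m]
      computable_comp[OF assms(1) computable_snd[OF computable_snd[OF computable_ident]]] assms
    by simp
qed

lemma computable_diff:
  assumes "computable f" "computable g"
  shows "computable (\<lambda>x. f x - g x :: nat)"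
proof -
  have "computable (\<lambda>n::nat. case n of 0 \<Rightarrow> 0 | Suc k \<Rightarrow> k)"
    by (intro computable_case_nat computable_ident computable_const computable_snd)
  then have "computable (\<lambda>n. n - 1 :: nat)"
    by (rule back_subst[of computable]) (auto split: nat.split)
  moreover have "((\<lambda>n. n - 1) ^^ n) m = m - n" for m n :: nat
    by (induction n) auto
  ultimately show ?thesis
    using computable_funpow[of "\<lambda>n. n - 1" g f] assms by simp
qed

lemma computable_if_eq:
  fixes a b :: "'a::encodable \<Rightarrow> 'b::encodable"
  assumes "computable a" "computable b" "computable f" "computable g"
  shows "computable (\<lambda>x. if a x = b x then f x else g x)"
proof -
  let ?d = "\<lambda>x. case enc (a x) - enc (b x) of
      0 \<Rightarrow> (case enc (b x) - enc (a x) of 0 \<Rightarrow> f x | Suc _ \<Rightarrow> g x) | Suc _ \<Rightarrow> g x"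
  have "computable ?d"
    using assms
    by (intro computable_case_nat computable_diff computable_enc computable_comp[OF assms(4)]
        computable_fst computable_ident)
  moreover have "?d x = (if a x = b x then f x else g x)" for x
    by (cases "enc (a x)" "enc (b x)" rule: linorder_cases)
      (auto simp: enc_inject split: nat.split)
  ultimately show ?thesis by simp
qed

lemma computable_Cons:
  assumes "computable f" "computable g"
  shows "computable (\<lambda>x. f x # g x)"
proof (rule computable_comp2[OF _ assms])
  show "computable (\<lambda>p::'b \<times> 'b list. fst p # snd p)"
    by (rule computableI[OF total_recursive_Suc]) (simp add: enc_Cons enc_prod_def)
qed

lemma computable_case_list:
  assumes "computable f" "computable a"
    and "computable (\<lambda>p. g (fst p) (fst (snd p)) (snd (snd p)))"
  shows "computable (\<lambda>x. case f x of [] \<Rightarrow> a x | y # ys \<Rightarrow> g x y ys)"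
proof -
  obtain f' a' g' where f': "total_recursive f'" "\<And>x. f' (enc x) = enc (f x)"
    and a': "total_recursive a'" "\<And>x. a' (enc x) = enc (a x)"
    and g': "total_recursive g'"
      "\<And>p. g' (enc p) = enc (g (fst p) (fst (snd p)) (snd (snd p)))"
    using assms by (meson computableE)
  let ?g = "\<lambda>m. g' (prod_encode (fst (prod_decode m), fst (prod_decode (snd (prod_decode m)))))"
  have "total_recursive ?g"
    by (intro total_recursive_comp[OF g'(1)] total_recursive_pair total_recursive_fst
        total_recursive_comp[OF total_recursive_fst total_recursive_snd])
  from total_recursive_rec_nat[OF a'(1) this f'(1)]
  have "total_recursive (\<lambda>n. rec_nat (a' n) (\<lambda>k _. g' (prod_encode (n, k))) (f' n))" by simp
  moreover have "g' (prod_encode (enc x, prod_encode (enc y, enc ys))) = enc (g x y ys)" for x y ys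
    using g'(2)[of "(x, y, ys)"] by (simp add: enc_prod_def)
  then have "rec_nat (a' (enc x)) (\<lambda>k _. g' (prod_encode (enc x, k))) (f' (enc x))
      = enc (case f x of [] \<Rightarrow> a x | y # ys \<Rightarrow> g x y ys)" for x
    by (auto simp: a' f' enc_Nil enc_Cons split: list.split)
  ultimately show ?thesis by (rule computableI)
qed

lemma computable_hd:
  assumes "computable f"
  shows "computable (\<lambda>x. hd (f x))"
proof -
  have "computable (\<lambda>x. case f x of [] \<Rightarrow> hd [] | y # _ \<Rightarrow> y)"
    by (intro computable_case_list assms computable_const computable_fst computable_snd
        computable_ident)
  then show ?thesis by (rule back_subst[of computable]) (auto split: list.split)
qed

lemma computable_tl:
  assumes "computable f"
  shows "computable (\<lambda>x. tl (f x))"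
proof -
  have "computable (\<lambda>x. case f x of [] \<Rightarrow> [] | _ # ys \<Rightarrow> ys)"
    by (intro computable_case_list assms computable_const computable_snd computable_ident)
  then show ?thesis by (simp add: tl_def)
qed

lemma computable_fold:
  assumes "computable (\<lambda>p. g (fst p) (snd p))" "computable f" "computable a"
  shows "computable (\<lambda>x. fold g (f x) (a x))"
proof -
  define step where
    "step s = (case fst s of [] \<Rightarrow> s | y # ys \<Rightarrow> (ys, g y (snd s)))" for s
  have "computable step"
    unfolding step_def[abs_def]
    by (intro computable_case_list computable_comp2[OF assms(1)] computable_Pair computable_fst
        computable_snd computable_ident)
  \<comment> \<open>The code of a list bounds its length, so it tells how often to iterate.\<close>
  then have "computable (\<lambda>x. (step ^^ enc (f x)) (f x, a x))"
    by (intro computable_funpow computable_enc computable_Pair assms(2,3))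
  moreover have "snd ((step ^^ n) (ys, b)) = fold g ys b" if "length ys \<le> n" for n ys b
    using that
  proof (induction n arbitrary: ys b)
    case (Suc n)
    then show ?case
      by (cases ys) (simp_all add: funpow_Suc_right step_def del: funpow.simps)
  qed simp
  ultimately show ?thesis
    using computable_snd[of "\<lambda>x. (step ^^ enc (f x)) (f x, a x)"] by (simp add: length_le_enc)
qed

lemma computable_rev:
  assumes "computable f"
  shows "computable (\<lambda>x. rev (f x))"
proof -
  have "computable (\<lambda>x. fold Cons (f x) [])"
    by (intro computable_fold computable_Cons computable_fst computable_snd computable_ident
        computable_const assms)
  then show ?thesis by (simp add: fold_Cons_rev)
qed

lemma computable_append:
  assumes "computable f" "computable g"
  shows "computable (\<lambda>x. f x @ g x)"
proof -
  have "computable (\<lambda>x. fold Cons (rev (f x)) (g x))"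
    by (intro computable_fold computable_Cons computable_fst computable_snd computable_ident
        computable_rev assms)
  then show ?thesis by (simp add: fold_Cons_rev)
qed

lemma computable_last: "computable f \<Longrightarrow> computable (\<lambda>x. last (f x))"
  unfolding hd_rev[symmetric] by (intro computable_hd computable_rev)

lemma computable_butlast:
  assumes "computable f"
  shows "computable (\<lambda>x. butlast (f x))"
proof -
  have "computable (\<lambda>x. rev (tl (rev (f x))))"
    by (intro computable_rev computable_tl assms)
  then show ?thesis by (simp flip: butlast_rev)
qed

lemma computable_binary_connective:
  assumes "\<And>A B. form_encode (c A B) = prod_encode (k, prod_encode (form_encode A, form_encode B))"
    and "computable f" "computable g"
  shows "computable (\<lambda>x. c (f x) (g x))"
proof (rule computable_comp2[OF _ assms(2,3)])
  show "computable (\<lambda>p. c (fst p) (snd p))"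
    by (rule computableI[OF total_recursive_pair[OF total_recursive_const[of k]
        total_recursive_ident]]) (simp add: enc_prod_def enc_form_def assms(1))
qed

lemmas computable_And = computable_binary_connective[OF form_encode.simps(2)]
lemmas computable_Or = computable_binary_connective[OF form_encode.simps(3)]
lemmas computable_Imp = computable_binary_connective[OF form_encode.simps(4)]

lemma computable_Neg: "computable f \<Longrightarrow> computable (\<lambda>x. Neg (f x))"
proof (rule computable_comp[of Neg])
  show "computable Neg"
    by (rule computableI[OF total_recursive_pair[OF total_recursive_const[of 4]
        total_recursive_ident]]) (simp add: enc_form_def)
qed

lemma computable_subst:
  assumes "\<And>n. computable (\<lambda>x. \<sigma> x n)"
  shows "computable (\<lambda>x. subst (\<sigma> x) A)"
  by (induction A)
    (auto intro: assms computable_And computable_Or computable_Imp computable_Neg)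

section \<open>Derivations in the Frege system\<close>

primrec derivation :: "form set \<Rightarrow> form set \<Rightarrow> form list \<Rightarrow> bool" where
  "derivation F H [] \<longleftrightarrow> True"
| "derivation F H (B # D) \<longleftrightarrow>
     (axiom_instance F B \<or> (\<exists>A \<in> H. Imp A B \<in> H)) \<and> derivation F (insert B H) D"

lemma derivation_append:
  "derivation F H (D @ E) \<longleftrightarrow> derivation F H D \<and> derivation F (H \<union> set D) E"
  by (induction D arbitrary: H) auto

lemma derivation_mono: "derivation F H D \<Longrightarrow> H \<subseteq> H' \<Longrightarrow> derivation F H' D"
proof (induction D arbitrary: H H')
  case (Cons B D)
  moreover have "insert B H \<subseteq> insert B H'" using Cons.prems(2) by blast
  ultimately show ?case by auto
qed simp

lemma subst_subst: "subst \<sigma> (subst \<tau> A) = subst (\<lambda>n. subst \<sigma> (\<tau> n)) A"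
  by (induction A) auto

lemma axiom_instance_subst: "axiom_instance F A \<Longrightarrow> axiom_instance F (subst \<sigma> A)"
  unfolding axiom_instance_def using subst_subst by blast

lemma derivation_subst:
  "derivation F H D \<Longrightarrow> derivation F (subst \<sigma> ` H) (map (subst \<sigma>) D)"
proof (induction D arbitrary: H)
  case (Cons B D)
  then have "axiom_instance F (subst \<sigma> B) \<or> (\<exists>A \<in> subst \<sigma> ` H. Imp A (subst \<sigma> B) \<in> subst \<sigma> ` H)"
    using axiom_instance_subst by force
  with Cons.IH[of "insert B H"] Cons.prems show ?case by simp
qed simp

lemma derivation_instance:
  assumes "derivation F {} D"
  shows "derivation F H (map (subst \<sigma>) D)"
  using derivation_mono[OF derivation_subst[OF assms], of \<sigma> H] by simp

lemma frege_provable_imp_derivation: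
  "frege_provable F A \<Longrightarrow> \<exists>D. derivation F {} D \<and> A \<in> set D"
proof (induction rule: frege_provable.induct)
  case (ax A)
  then have "derivation F {} [A]" by simp
  then show ?case by fastforce
next
  case (mp A B)
  then obtain D E where D: "derivation F {} D" "A \<in> set D"
    and E: "derivation F {} E" "Imp A B \<in> set E"
    by blast
  then have "derivation F {} (D @ E @ [B])"
    by (auto simp: derivation_append intro: derivation_mono)
  then show ?case by fastforce
qed

lemma classical_frege_system_derivation:
  assumes "classical_frege_system F" "finite T" "\<And>A. A \<in> T \<Longrightarrow> tautology A"
  shows "\<exists>D. derivation F {} D \<and> T \<subseteq> set D"
  using assms(2,3)
proof (induction T rule: finite_induct)
  case empty
  have "derivation F {} []" by simp
  then show ?case by blast
next
  case (insert A T)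
  then obtain D where D: "derivation F {} D" "T \<subseteq> set D" by blast
  have "frege_provable F A"
    using assms(1) insert.prems unfolding classical_frege_system_def by blast
  then obtain E where E: "derivation F {} E" "A \<in> set E"
    using frege_provable_imp_derivation by blast
  with D have "derivation F {} (D @ E)" "insert A T \<subseteq> set (D @ E)"
    by (auto simp: derivation_append intro: derivation_mono)
  then show ?case by blast
qed

lemma classical_frege_system_or_elim:
  assumes "classical_frege_system F"
  shows "axiom_instance F (or_elim_schema A B C)"
proof -
  obtain a b c where "distinct [a, b, c]" "or_elim_schema (Var a) (Var b) (Var c) \<in> F"
    using assms unfolding classical_frege_system_def by blast
  moreover from this have "or_elim_schema A B C
      = subst (Var(a := A, b := B, c := C)) (or_elim_schema (Var a) (Var b) (Var c))"
    by (auto simp: or_elim_schema_def)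
  ultimately show ?thesis unfolding axiom_instance_def by blast
qed

definition or_elim_steps :: "form \<Rightarrow> form \<Rightarrow> form \<Rightarrow> form list" where
  "or_elim_steps A B C =
     [or_elim_schema A B C, Imp (Imp B C) (Imp (Or A B) C), Imp (Or A B) C]"

lemma derivation_or_elim_steps:
  assumes "axiom_instance F (or_elim_schema A B C)" "{Imp A C, Imp B C, Or A B} \<subseteq> H"
  shows "derivation F H (or_elim_steps A B C @ [C])"
  using assms by (auto simp: or_elim_steps_def or_elim_schema_def)

section \<open>Nested systems without positions\<close>

text \<open>
  A frame describes an open block: its assumption and the formulas that were available when it was
  opened. In \<open>nd_state F P K H\<close> and \<open>no_state F P K H\<close>, the lines \<open>P\<close> have led to the open blocks
  \<open>K\<close>, innermost first, and \<open>H\<close> are the available formulas. Closing a block restores the formulas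
  stored in its frame.
\<close>

type_synonym frame = "form \<times> form set"

primrec frames_ctx :: "frame list \<Rightarrow> ctx" where
  "frames_ctx [] = []"
| "frames_ctx (f # K) = frames_ctx K @ [fst f]"

inductive nd_state :: "form set \<Rightarrow> line list \<Rightarrow> frame list \<Rightarrow> form set \<Rightarrow> bool" for F where
  nd_state_empty: "nd_state F [] [] {}"
| nd_state_axiom: "\<lbrakk>nd_state F P K H; axiom_instance F A\<rbrakk>
    \<Longrightarrow> nd_state F (P @ [(frames_ctx K, A)]) K (insert A H)"
| nd_state_assume: "nd_state F P K H
    \<Longrightarrow> nd_state F (P @ [(frames_ctx K @ [A], A)]) ((A, H) # K) (insert A H)"
| nd_state_mp: "\<lbrakk>nd_state F P K H; A \<in> H; Imp A B \<in> H\<rbrakk>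
    \<Longrightarrow> nd_state F (P @ [(frames_ctx K, B)]) K (insert B H)"
| nd_state_deduction: "\<lbrakk>nd_state F P ((A, G) # K) H; last P = (frames_ctx K @ [A], B)\<rbrakk>
    \<Longrightarrow> nd_state F (P @ [(frames_ctx K, Imp A B)]) K (insert (Imp A B) G)"

text \<open>\<open>Second_branch A C B G\<close> is a block with assumption \<open>B\<close> that follows a block with assumption
  \<open>A\<close> and last line \<open>C\<close>.\<close>

datatype branch =
    First_branch form "form set"
  | Second_branch form form form "form set"

primrec branch_frame :: "branch \<Rightarrow> frame" where
  "branch_frame (First_branch A G) = (A, G)"
| "branch_frame (Second_branch A C B G) = (B, G)"

primrec first_assumption :: "branch \<Rightarrow> form" where
  "first_assumption (First_branch A G) = A"
| "first_assumption (Second_branch A C B G) = A"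

abbreviation branches_ctx :: "branch list \<Rightarrow> ctx" where
  "branches_ctx K \<equiv> frames_ctx (map branch_frame K)"

inductive no_state :: "form set \<Rightarrow> line list \<Rightarrow> branch list \<Rightarrow> form set \<Rightarrow> bool" for F where
  no_state_empty: "no_state F [] [] {}"
| no_state_axiom: "\<lbrakk>no_state F P K H; axiom_instance F A\<rbrakk>
    \<Longrightarrow> no_state F (P @ [(branches_ctx K, A)]) K (insert A H)"
| no_state_assume: "no_state F P K H
    \<Longrightarrow> no_state F (P @ [(branches_ctx K @ [A], A)]) (First_branch A H # K) (insert A H)"
| no_state_assume_second: "\<lbrakk>no_state F P (First_branch A G # K) H;
      last P = (branches_ctx K @ [A], C)\<rbrakk>
    \<Longrightarrow> no_state F (P @ [(branches_ctx K @ [B], B)]) (Second_branch A C B G # K) (insert B G)"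
| no_state_mp: "\<lbrakk>no_state F P K H; A \<in> H; Imp A B \<in> H\<rbrakk>
    \<Longrightarrow> no_state F (P @ [(branches_ctx K, B)]) K (insert B H)"
| no_state_or_elim: "\<lbrakk>no_state F P (Second_branch A C B G # K) H; Or A B \<in> G;
      last P = (branches_ctx K @ [B], C)\<rbrakk>
    \<Longrightarrow> no_state F (P @ [(branches_ctx K, C)]) K (insert C G)"

lemma current_ctx_Nil [simp]: "current_ctx [] = []"
  by (simp add: current_ctx_def)

lemma current_ctx_snoc [simp]: "current_ctx (P @ [l]) = fst l"
  by (simp add: current_ctx_def)

lemma nd_state_current_ctx: "nd_state F P K H \<Longrightarrow> current_ctx P = frames_ctx K"
  by (induction rule: nd_state.induct) simp_all

lemma no_state_current_ctx: "no_state F P K H \<Longrightarrow> current_ctx P = branches_ctx K"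
  by (induction rule: no_state.induct) simp_all

lemma derivation_lines_induct:
  assumes "derivation F H D" "Q P H"
    and "\<And>P H B. Q P H \<Longrightarrow> axiom_instance F B \<Longrightarrow> Q (P @ [(\<Gamma>, B)]) (insert B H)"
    and "\<And>P H A B. Q P H \<Longrightarrow> A \<in> H \<Longrightarrow> Imp A B \<in> H \<Longrightarrow> Q (P @ [(\<Gamma>, B)]) (insert B H)"
  shows "Q (P @ map (Pair \<Gamma>) D) (H \<union> set D)"
  using assms(1,2)
proof (induction D arbitrary: P H)
  case (Cons B D)
  then have "Q (P @ [(\<Gamma>, B)]) (insert B H)" using assms(3,4) by auto
  from Cons.IH[OF _ this] Cons.prems(1) show ?case by simp
qed simp

lemma nd_state_derivation:
  assumes "nd_state F P K H" "derivation F H D"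
  shows "nd_state F (P @ map (Pair (frames_ctx K)) D) K (H \<union> set D)"
  using assms(2,1) by (rule derivation_lines_induct) (fact nd_state_axiom, fact nd_state_mp)

lemma no_state_derivation:
  assumes "no_state F P K H" "derivation F H D"
  shows "no_state F (P @ map (Pair (branches_ctx K)) D) K (H \<union> set D)"
  using assms(2,1) by (rule derivation_lines_induct) (fact no_state_axiom, fact no_state_mp)

subsection \<open>Equivalence with the original systems\<close>

definition live_formulas :: "line list \<Rightarrow> nat set \<Rightarrow> nat \<Rightarrow> form set" where
  "live_formulas P U n = {snd (P ! i) | i. i < n \<and> i \<notin> U}"

fun frames_at :: "line list \<Rightarrow> nat set \<Rightarrow> nat \<Rightarrow> nat list \<Rightarrow> frame list \<Rightarrow> bool" where
  "frames_at P U n [] [] \<longleftrightarrow> (\<forall>i \<in> {..<n} - U. fst (P ! i) = [])"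
| "frames_at P U n (s # S) ((A, G) # K) \<longleftrightarrow>
     s < n \<and> P ! s = (frames_ctx K @ [A], A) \<and> G = live_formulas P U s \<and>
     (\<forall>i \<in> {s..<n} - U. fst (P ! i) = frames_ctx K @ [A]) \<and> frames_at P U s S K"
| "frames_at P U n _ _ \<longleftrightarrow> False"

lemma live_formulas_cong:
  assumes "\<And>i. i < n \<Longrightarrow> P' ! i = P ! i" "\<And>i. i < n \<Longrightarrow> i \<in> U' \<longleftrightarrow> i \<in> U"
  shows "live_formulas P' U' n = live_formulas P U n"
  unfolding live_formulas_def using assms by metis

lemma frames_at_cong:
  assumes "\<And>i. i < n \<Longrightarrow> P' ! i = P ! i" "\<And>i. i < n \<Longrightarrow> i \<in> U' \<longleftrightarrow> i \<in> U"
  shows "frames_at P' U' n S K \<longleftrightarrow> frames_at P U n S K"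
  using assms
proof (induction P U n S K rule: frames_at.induct)
  case (2 P U n s S A G K)
  show ?case
  proof (cases "s < n")
    case True
    with 2 have "frames_at P' U' s S K \<longleftrightarrow> frames_at P U s S K" by simp
    moreover have "live_formulas P' U' s = live_formulas P U s"
      using 2(2,3) True by (intro live_formulas_cong) auto
    ultimately show ?thesis using 2(2,3) True by auto
  qed simp
qed auto

lemma frames_at_extend:
  assumes "frames_at P U n S K" "n \<le> m"
    and "\<And>i. n \<le> i \<Longrightarrow> i < m \<Longrightarrow> i \<notin> U \<Longrightarrow> fst (P ! i) = frames_ctx K"
  shows "frames_at P U m S K"
  using assms by (cases "(P, U, n, S, K)" rule: frames_at.cases) (force simp: not_le)+

lemma frames_at_prefix:
  "frames_at P U n S K \<Longrightarrow> i < n \<Longrightarrow> i \<notin> U \<Longrightarrow> prefix (fst (P ! i)) (frames_ctx K)"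
proof (induction P U n S K rule: frames_at.induct)
  case (2 P U n s S A G K)
  then show ?case by (cases "i < s") (auto simp: prefix_append)
qed auto

definition represents ::
  "line list \<Rightarrow> nat list \<Rightarrow> nat set \<Rightarrow> frame list \<Rightarrow> form set \<Rightarrow> bool" where
  "represents P S U K H \<longleftrightarrow>
     U \<subseteq> {..<length P} \<and> H = live_formulas P U (length P) \<and> frames_at P U (length P) S K"

lemma represents_Nil: "represents [] [] {} [] {}"
  by (simp add: represents_def live_formulas_def)

lemma represents_line:
  assumes "represents P S U K H"
  shows "represents (P @ [(frames_ctx K, A)]) S U K (insert A H)"
proof -
  let ?P = "P @ [(frames_ctx K, A)]"
  have "frames_at ?P U (length P) S K"
    using assms frames_at_cong[of "length P" ?P P] by (simp add: represents_def nth_append)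
  then have "frames_at ?P U (length ?P) S K"
    by (rule frames_at_extend) (auto simp: nth_append)
  with assms show ?thesis
    by (auto simp: represents_def live_formulas_def nth_append less_Suc_eq)
qed

lemma represents_assume:
  assumes "represents P S U K H"
  shows "represents (P @ [(frames_ctx K @ [A], A)]) (length P # S) U ((A, H) # K) (insert A H)"
proof -
  let ?P = "P @ [(frames_ctx K @ [A], A)]"
  have "frames_at ?P U (length P) S K"
    using assms frames_at_cong[of "length P" ?P P] by (simp add: represents_def nth_append)
  moreover have "live_formulas ?P U (length P) = H"
    using assms live_formulas_cong[of "length P" ?P P] by (simp add: represents_def nth_append)
  ultimately show ?thesis
    using assms by (auto simp: represents_def live_formulas_def nth_append less_Suc_eq)
qed

lemma represents_close:
  assumes "represents P (s # S) U ((A, G) # K) H"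
  shows "represents P S (U \<union> {s..<length P}) K G"
proof -
  let ?U = "U \<union> {s..<length P}"
  have s: "s < length P" and G: "G = live_formulas P U s" and "frames_at P U s S K"
    using assms by (auto simp: represents_def)
  then have "frames_at P ?U s S K"
    using frames_at_cong[of s P P ?U U] by simp
  then have "frames_at P ?U (length P) S K"
    using s by (auto intro: frames_at_extend)
  then show ?thesis
    using assms s G by (auto simp: represents_def live_formulas_def)
qed

lemma represents_ConsE:
  assumes "represents P (s # S) U K H"
  obtains A G K' where "K = (A, G) # K'" "P ! s = (frames_ctx K' @ [A], A)"
  using assms by (cases K) (auto simp: represents_def)

lemma represents_Cons_less: "represents P (s # S) U K H \<Longrightarrow> s < length P"
  by (cases K) (auto simp: represents_def)

lemma represents_available:
  assumes "represents P S U K H"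
  shows "available P U (frames_ctx K) A \<longleftrightarrow> A \<in> H"
  using assms frames_at_prefix
  unfolding represents_def available_def live_formulas_def by blast

lemma represents_available_outer:
  assumes "represents P (s # S) U ((B, G) # K) H"
  shows "available P U (frames_ctx K) A \<longleftrightarrow> A \<in> G"
proof
  assume "available P U (frames_ctx K) A"
  then obtain i where i: "i < length P" "i \<notin> U" "prefix (fst (P ! i)) (frames_ctx K)"
    and A: "snd (P ! i) = A"
    by (auto simp: available_def)
  then have "i < s"
    using assms prefix_length_le[OF i(3)] by (force simp: represents_def not_less)
  with i A assms show "A \<in> G" by (auto simp: represents_def live_formulas_def)
next
  assume "A \<in> G"
  with assms obtain i where "i < s" "i \<notin> U" "snd (P ! i) = A" "s < length P"
    "frames_at P U s S K"
    by (auto simp: represents_def live_formulas_def)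
  then show "available P U (frames_ctx K) A"
    unfolding available_def by (intro exI[of _ i]) (auto intro: frames_at_prefix)
qed

lemma nd_lines_imp_nd_state:
  "nd_lines F P S U \<Longrightarrow> \<exists>K H. nd_state F P K H \<and> represents P S U K H"
proof (induction rule: nd_lines.induct)
  case nd_empty
  show ?case using nd_state_empty represents_Nil by blast
next
  case (nd_axiom P S U A)
  then obtain K H where K: "nd_state F P K H" "represents P S U K H" by blast
  then show ?case
    using nd_state_axiom[OF K(1) nd_axiom(2)] represents_line[OF K(2)]
    unfolding nd_state_current_ctx[OF K(1)] by blast
next
  case (nd_assume P S U A)
  then obtain K H where K: "nd_state F P K H" "represents P S U K H" by blast
  then show ?case
    using nd_state_assume[OF K(1)] represents_assume[OF K(2)]
    unfolding nd_state_current_ctx[OF K(1)] by blast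
next
  case (nd_mp P S U A B)
  then obtain K H where K: "nd_state F P K H" "represents P S U K H" by blast
  with nd_mp(2,3) have H: "A \<in> H" "Imp A B \<in> H"
    by (simp_all add: nd_state_current_ctx represents_available)
  then show ?case
    using nd_state_mp[OF K(1) H] represents_line[OF K(2)]
    unfolding nd_state_current_ctx[OF K(1)] by blast
next
  case (nd_deduction P i S U \<Gamma> A B)
  then obtain K H where K: "nd_state F P K H" "represents P (i # S) U K H" by blast
  from K(2) nd_deduction(2) obtain G K' where K': "K = (A, G) # K'" "\<Gamma> = frames_ctx K'"
    by (auto elim: represents_ConsE)
  with K nd_deduction(3) show ?case
    using nd_state_deduction represents_line[OF represents_close] by blast
qed

lemma nd_state_imp_nd_lines:
  "nd_state F P K H \<Longrightarrow> \<exists>S U. nd_lines F P S U \<and> represents P S U K H"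
proof (induction rule: nd_state.induct)
  case nd_state_empty
  show ?case using nd_empty represents_Nil by blast
next
  case (nd_state_axiom P K H A)
  then obtain S U where lines: "nd_lines F P S U" "represents P S U K H" by blast
  then show ?case
    using nd_axiom[OF lines(1) nd_state_axiom(2)] represents_line[OF lines(2)]
    unfolding nd_state_current_ctx[OF nd_state_axiom(1)] by blast
next
  case (nd_state_assume P K H A)
  then obtain S U where lines: "nd_lines F P S U" "represents P S U K H" by blast
  then show ?case
    using nd_assume[OF lines(1), of A] represents_assume[OF lines(2), of A]
    unfolding nd_state_current_ctx[OF nd_state_assume(1)] by blast
next
  case (nd_state_mp P K H A B)
  then obtain S U where lines: "nd_lines F P S U" "represents P S U K H" by blast
  with nd_state_mp(1-3)
  have "available P U (current_ctx P) A" "available P U (current_ctx P) (Imp A B)"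
    by (simp_all add: nd_state_current_ctx represents_available)
  then show ?case
    using nd_mp[OF lines(1)] represents_line[OF lines(2)]
    unfolding nd_state_current_ctx[OF nd_state_mp(1)] by blast
next
  case (nd_state_deduction P A G K H B)
  then obtain S' U where lines: "nd_lines F P S' U" "represents P S' U ((A, G) # K) H" by blast
  then obtain s S where S': "S' = s # S" by (cases S') (auto simp: represents_def)
  with lines(2) have "P ! s = (frames_ctx K @ [A], A)" by (auto elim: represents_ConsE)
  from nd_deduction[OF lines(1)[unfolded S'] this nd_state_deduction(2)]
    represents_line[OF represents_close[OF lines(2)[unfolded S']]]
  show ?case by blast
qed

lemma nd_proof_iff:
  "nd_proof F P A \<longleftrightarrow> (\<exists>K H. nd_state F P K H) \<and> P \<noteq> [] \<and> last P = ([], A)"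
  unfolding nd_proof_def using nd_lines_imp_nd_state nd_state_imp_nd_lines by metis

primrec block_start :: "block \<Rightarrow> nat" where
  "block_start (First i) = i"
| "block_start (Second i k) = k"

fun branch_at :: "line list \<Rightarrow> block \<Rightarrow> branch \<Rightarrow> bool" where
  "branch_at P (First i) (First_branch A G) \<longleftrightarrow> True"
| "branch_at P (Second i k) (Second_branch A C B G) \<longleftrightarrow> i < k \<and> k < length P \<and>
     (\<exists>\<Gamma>. P ! i = (\<Gamma> @ [A], A) \<and> P ! (k - 1) = (\<Gamma> @ [A], C) \<and> P ! k = (\<Gamma> @ [B], B))"
| "branch_at P _ _ \<longleftrightarrow> False"

lemma branch_at_append: "branch_at P b c \<Longrightarrow> branch_at (P @ Q) b c"
  by (induction P b c rule: branch_at.induct) (auto simp: nth_append)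

definition represents_branches ::
  "line list \<Rightarrow> block list \<Rightarrow> nat set \<Rightarrow> branch list \<Rightarrow> form set \<Rightarrow> bool" where
  "represents_branches P S U K H \<longleftrightarrow>
     represents P (map block_start S) U (map branch_frame K) H \<and> list_all2 (branch_at P) S K"

lemma represents_branches_line:
  assumes "represents_branches P S U K H"
  shows "represents_branches (P @ [(branches_ctx K, A)]) S U K (insert A H)"
  using assms represents_line branch_at_append
  unfolding represents_branches_def by (metis list_all2_mono)

lemma represents_branches_assume:
  assumes "represents_branches P S U K H"
  shows "represents_branches (P @ [(branches_ctx K @ [A], A)]) (First (length P) # S) U
    (First_branch A H # K) (insert A H)"
  using assms represents_assume[of P "map block_start S" U "map branch_frame K" H A]
  by (auto simp: represents_branches_def elim: list_all2_mono intro: branch_at_append)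

lemma represents_branches_assume_second:
  assumes "represents_branches P (First i # S) U (First_branch A G # K) H"
    and last: "last P = (branches_ctx K @ [A], C)"
  shows "represents_branches (P @ [(branches_ctx K @ [B], B)]) (Second i (length P) # S)
    (U \<union> {i..<length P}) (Second_branch A C B G # K) (insert B G)"
proof -
  have P: "represents P (i # map block_start S) U ((A, G) # map branch_frame K) H"
    and rest: "list_all2 (branch_at P) S K"
    using assms(1) by (auto simp: represents_branches_def)
  have "i < length P" "P ! i = (branches_ctx K @ [A], A)"
    using P by (auto simp: represents_Cons_less elim: represents_ConsE)
  moreover from this have "P ! (length P - 1) = (branches_ctx K @ [A], C)"
    using last by (subst last_conv_nth[symmetric]) auto
  ultimately have "branch_at (P @ [(branches_ctx K @ [B], B)]) (Second i (length P))
      (Second_branch A C B G)"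
    by (auto simp: nth_append)
  moreover have "list_all2 (branch_at (P @ [(branches_ctx K @ [B], B)])) S K"
    using rest by (rule list_all2_mono) (rule branch_at_append)
  ultimately show ?thesis
    using represents_assume[OF represents_close[OF P], of B] by (simp add: represents_branches_def)
qed

lemma represents_branches_close:
  assumes "represents_branches P (Second i k # S) U (Second_branch A C B G # K) H"
  shows "represents_branches P S (U \<union> {k..<length P}) K G"
  using assms represents_close by (auto simp: represents_branches_def)

lemma represents_branches_FirstE:
  assumes "represents_branches P (First i # S) U K H"
  obtains A G K' where "K = First_branch A G # K'"
  using assms by (auto simp: represents_branches_def list_all2_Cons1 elim: branch_at.elims)

lemma represents_branches_SecondE:
  assumes "represents_branches P (Second i k # S) U K H"
  obtains A C B G K' where "K = Second_branch A C B G # K'"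
    "P ! i = (branches_ctx K' @ [A], A)" "P ! (k - 1) = (branches_ctx K' @ [A], C)"
    "P ! k = (branches_ctx K' @ [B], B)"
proof -
  from assms obtain c K' where K: "K = c # K'" and c: "branch_at P (Second i k) c"
    by (auto simp: represents_branches_def list_all2_Cons1)
  then obtain A C B G where c': "c = Second_branch A C B G" by (cases c) auto
  have "P ! k = (branches_ctx K' @ [B], B)"
    using assms K c' by (auto simp: represents_branches_def elim: represents_ConsE)
  then show ?thesis using that K c c' by auto
qed

lemma represents_branches_First_branchE:
  assumes "represents_branches P S U (First_branch A G # K) H"
  obtains i S' where "S = First i # S'"
  using assms by (auto simp: represents_branches_def list_all2_Cons2 elim: branch_at.elims)

lemma represents_branches_Second_branchE:
  assumes "represents_branches P S U (Second_branch A C B G # K) H"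
  obtains i k S' where "S = Second i k # S'"
  using assms by (auto simp: represents_branches_def list_all2_Cons2 elim: branch_at.elims)

lemma represents_branches_Nil: "represents_branches [] [] {} [] {}"
  by (simp add: represents_branches_def represents_Nil)

lemma represents_branches_available:
  assumes "represents_branches P S U K H"
  shows "available P U (branches_ctx K) A \<longleftrightarrow> A \<in> H"
  using assms represents_available unfolding represents_branches_def by blast

lemma represents_branches_available_outer:
  assumes "represents_branches P (b # S) U (c # K) H"
  shows "available P U (branches_ctx K) A \<longleftrightarrow> A \<in> snd (branch_frame c)"
  using assms represents_available_outer[of P "block_start b" "map block_start S" U
      "fst (branch_frame c)" "snd (branch_frame c)" "map branch_frame K" H A]
  unfolding represents_branches_def by simp

lemma no_state_represents_or_elim:
  assumes K: "no_state F P K H" "represents_branches P (Second i k # S) U K H"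
    and disj: "available P U \<Gamma> (Or A B)"
    and blocks: "P ! i = (\<Gamma> @ [A], A)" "P ! (k - 1) = (\<Gamma> @ [A], C)" "P ! k = (\<Gamma> @ [B], B)"
    and last: "last P = (\<Gamma> @ [B], C)"
  shows "\<exists>K' H'. no_state F (P @ [(\<Gamma>, C)]) K' H' \<and>
    represents_branches (P @ [(\<Gamma>, C)]) S (U \<union> {k..<length P}) K' H'"
proof -
  obtain G K' where K': "K = Second_branch A C B G # K'" "\<Gamma> = branches_ctx K'"
    using K(2) blocks by (auto elim: represents_branches_SecondE)
  have "Or A B \<in> G"
    using K(2) disj by (simp add: K' represents_branches_available_outer)
  then have "no_state F (P @ [(\<Gamma>, C)]) K' (insert C G)"
    using K(1) last unfolding K' by (intro no_state_or_elim)
  with K(2) show ?thesis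
    unfolding K' using represents_branches_line[OF represents_branches_close] by blast
qed

lemma no_lines_imp_no_state:
  "no_lines F P S U \<Longrightarrow> \<exists>K H. no_state F P K H \<and> represents_branches P S U K H"
proof (induction rule: no_lines.induct)
  case no_empty
  show ?case using no_state_empty represents_branches_Nil by blast
next
  case (no_axiom P S U A)
  then obtain K H where K: "no_state F P K H" "represents_branches P S U K H" by blast
  then show ?case
    using no_state_axiom[OF K(1) no_axiom(2)] represents_branches_line[OF K(2)]
    unfolding no_state_current_ctx[OF K(1)] by blast
next
  case (no_assume P S U A)
  then obtain K H where K: "no_state F P K H" "represents_branches P S U K H" by blast
  then show ?case
    using no_state_assume[OF K(1)] represents_branches_assume[OF K(2)]
    unfolding no_state_current_ctx[OF K(1)] by blast
next
  case (no_assume_second P i S U \<Gamma> A B)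
  then obtain K H where K: "no_state F P K H" "represents_branches P (First i # S) U K H" by blast
  with no_assume_second(2) obtain G K' where
    K': "K = First_branch A G # K'" "\<Gamma> = branches_ctx K'"
    by (auto elim!: represents_branches_FirstE dest: no_state_current_ctx)
  have "P \<noteq> []" using no_assume_second(2) by auto
  then have "last P = (branches_ctx K' @ [A], snd (last P))"
    using no_assume_second(2) K' by (simp add: current_ctx_def prod_eq_iff)
  with K K' show ?case
    using no_state_assume_second represents_branches_assume_second by blast
next
  case (no_mp P S U A B)
  then obtain K H where K: "no_state F P K H" "represents_branches P S U K H" by blast
  with no_mp(2,3) have H: "A \<in> H" "Imp A B \<in> H"
    by (simp_all add: no_state_current_ctx represents_branches_available)
  then show ?case
    using no_state_mp[OF K(1) H] represents_branches_line[OF K(2)]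
    unfolding no_state_current_ctx[OF K(1)] by blast
next
  case (no_or_elim P i k S U \<Gamma> A B C)
  then show ?case using no_state_represents_or_elim by blast
qed

lemma no_lines_represent_or_elim:
  assumes lines: "no_lines F P S U" "represents_branches P S U (Second_branch A C B G # K) H"
    and "Or A B \<in> G" "last P = (branches_ctx K @ [B], C)"
  shows "\<exists>S' U'. no_lines F (P @ [(branches_ctx K, C)]) S' U' \<and>
    represents_branches (P @ [(branches_ctx K, C)]) S' U' K (insert C G)"
proof -
  obtain i k S' where S: "S = Second i k # S'"
    using lines(2) by (rule represents_branches_Second_branchE)
  have "available P U (branches_ctx K) (Or A B)"
    using lines(2) assms(3) by (simp add: S represents_branches_available_outer)
  moreover have "P ! i = (branches_ctx K @ [A], A)" "P ! (k - 1) = (branches_ctx K @ [A], C)"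
    "P ! k = (branches_ctx K @ [B], B)"
    using lines(2)[unfolded S] by (auto elim: represents_branches_SecondE)
  ultimately have "no_lines F (P @ [(branches_ctx K, C)]) S' (U \<union> {k..<length P})"
    using no_or_elim[OF lines(1)[unfolded S]] assms(4) by blast
  then show ?thesis
    using represents_branches_line[OF represents_branches_close[OF lines(2)[unfolded S]]] by blast
qed

lemma no_state_imp_no_lines:
  "no_state F P K H \<Longrightarrow> \<exists>S U. no_lines F P S U \<and> represents_branches P S U K H"
proof (induction rule: no_state.induct)
  case no_state_empty
  show ?case using no_empty represents_branches_Nil by blast
next
  case (no_state_axiom P K H A)
  then obtain S U where lines: "no_lines F P S U" "represents_branches P S U K H" by blast
  then show ?case
    using no_axiom[OF lines(1) no_state_axiom(2)] represents_branches_line[OF lines(2)]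
    unfolding no_state_current_ctx[OF no_state_axiom(1)] by blast
next
  case (no_state_assume P K H A)
  then obtain S U where lines: "no_lines F P S U" "represents_branches P S U K H" by blast
  then show ?case
    using no_assume[OF lines(1), of A] represents_branches_assume[OF lines(2), of A]
    unfolding no_state_current_ctx[OF no_state_assume(1)] by blast
next
  case (no_state_assume_second P A G K H C B)
  then obtain S' U where
    lines: "no_lines F P S' U" "represents_branches P S' U (First_branch A G # K) H" by blast
  then obtain i S where S': "S' = First i # S" by (elim represents_branches_First_branchE)
  have "current_ctx P = branches_ctx K @ [A]"
    using no_state_current_ctx[OF no_state_assume_second(1)] by simp
  from no_lines.no_assume_second[OF lines(1)[unfolded S'] this]
    represents_branches_assume_second[OF lines(2)[unfolded S'] no_state_assume_second(2)]
  show ?case by blast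
next
  case (no_state_mp P K H A B)
  then obtain S U where lines: "no_lines F P S U" "represents_branches P S U K H" by blast
  with no_state_mp(1-3)
  have "available P U (current_ctx P) A" "available P U (current_ctx P) (Imp A B)"
    by (simp_all add: no_state_current_ctx represents_branches_available)
  then show ?case
    using no_mp[OF lines(1)] represents_branches_line[OF lines(2)]
    unfolding no_state_current_ctx[OF no_state_mp(1)] by blast
next
  case (no_state_or_elim P A C B G K H)
  then show ?case using no_lines_represent_or_elim by blast
qed

lemma no_proof_iff:
  "no_proof F P A \<longleftrightarrow> (\<exists>K H. no_state F P K H) \<and> P \<noteq> [] \<and> last P = ([], A)"
  unfolding no_proof_def using no_lines_imp_no_state no_state_imp_no_lines by metis

section \<open>Translations that insert lines\<close>

primrec interleave :: "('a \<Rightarrow> 's \<Rightarrow> 's) \<Rightarrow> ('a \<Rightarrow> 's \<Rightarrow> 'a list) \<Rightarrow> 's \<Rightarrow> 'a list \<Rightarrow> 'a list" where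
  "interleave next ins s [] = []"
| "interleave next ins s (x # xs) = ins x s @ x # interleave next ins (next x s) xs"

lemma interleave_snoc:
  "interleave next ins s (xs @ [x]) = interleave next ins s xs @ ins x (fold next xs s) @ [x]"
  by (induction xs arbitrary: s) simp_all

lemma interleave_eq_Nil_iff: "interleave next ins s xs = [] \<longleftrightarrow> xs = []"
  by (cases xs) simp_all

lemma last_interleave: "last (interleave next ins s xs) = last xs"
  by (cases xs rule: rev_cases) (simp_all add: interleave_snoc)

lemma length_interleave:
  assumes "\<And>x s. length (ins x s) \<le> b"
  shows "length (interleave next ins s xs) \<le> Suc b * length xs"
proof (induction xs arbitrary: s)
  case (Cons x xs)
  show ?case using Cons.IH[of "next x s"] assms[of x s] by simp
qed simp

lemma computable_interleave:
  fixes s :: "'s::encodable"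
  assumes "computable (\<lambda>p. next (fst p) (snd p))" "computable (\<lambda>p. ins (fst p) (snd p))"
  shows "computable (interleave next ins s)"
proof -
  let ?step = "\<lambda>x p. (next x (fst p), snd p @ ins x (fst p) @ [x])"
  have "computable (\<lambda>xs. snd (fold ?step xs (s, [])))"
    by (intro computable_snd computable_fold computable_Pair computable_append computable_Cons
        computable_comp2[OF assms(1)] computable_comp2[OF assms(2)] computable_fst
        computable_ident computable_const)
  moreover have "snd (fold ?step xs (s, out)) = out @ interleave next ins s xs" for xs s out
    by (induction xs arbitrary: s out) simp_all
  ultimately show ?thesis by simp
qed

lemma linearly_simulates_interleave:
  fixes s :: "'s::encodable"
  assumes "computable (\<lambda>p. next (fst p) (snd p))" "computable (\<lambda>p. ins (fst p) (snd p))"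
    and "\<And>l s. length (ins l s) \<le> b"
    and "\<And>P A. P_proof P A \<Longrightarrow> Q_proof (interleave next ins s P) A"
  shows "linearly_simulates Q_proof P_proof"
proof -
  obtain g where "total_recursive g" "\<And>P. g (enc P) = enc (interleave next ins s P)"
    using computable_interleave[OF assms(1,2), of s] unfolding computable_def by blast
  then show ?thesis
    unfolding linearly_simulates_def total_recursive_def enc_eq_proof_encode
    using assms(4) length_interleave[of ins b, OF assms(3)] by blast
qed

text \<open>The formula of the initial line is irrelevant; this one makes
  \<open>fold_initial_line\<close> hold without exception.\<close>

definition initial_line :: line where
  "initial_line = ([], snd (last ([] :: line list)))"

lemma fold_initial_line: "fold (\<lambda>l _. l) P initial_line = (current_ctx P, snd (last P))"
  by (cases P rule: rev_cases) (simp_all add: initial_line_def current_ctx_def prod_eq_iff)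

definition pair_subst :: "form \<Rightarrow> form \<Rightarrow> nat \<Rightarrow> form" where
  "pair_subst A B = (\<lambda>_. B)(0 := A)"

definition instance_lines :: "ctx \<Rightarrow> form \<Rightarrow> form \<Rightarrow> form list \<Rightarrow> line list" where
  "instance_lines \<Gamma> A B D = map (Pair \<Gamma>) (map (subst (pair_subst A B)) D)"

lemma length_instance_lines [simp]: "length (instance_lines \<Gamma> A B D) = length D"
  by (simp add: instance_lines_def)

lemma computable_instance_lines:
  assumes "computable c" "computable f" "computable g"
  shows "computable (\<lambda>x. instance_lines (c x) (f x) (g x) D)"
proof -
  have "computable (\<lambda>x. pair_subst (f x) (g x) n)" for n
    using assms(2,3) by (cases n) (simp_all add: pair_subst_def)
  then show ?thesis
    using assms(1) unfolding instance_lines_def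
    by (induction D) (simp_all add: computable_const computable_Cons computable_Pair
        computable_subst del: map_map)
qed

lemma nd_state_instance_lines:
  assumes "nd_state F P K H" "derivation F {} D"
  shows "nd_state F (P @ instance_lines (frames_ctx K) A B D) K
    (H \<union> set (map (subst (pair_subst A B)) D))"
  unfolding instance_lines_def
  using assms by (intro nd_state_derivation derivation_instance)

lemma no_state_instance_lines:
  assumes "no_state F P K H" "derivation F {} D"
  shows "no_state F (P @ instance_lines (branches_ctx K) A B D) K
    (H \<union> set (map (subst (pair_subst A B)) D))"
  unfolding instance_lines_def
  using assms by (intro no_state_derivation derivation_instance)

section \<open>From nested deduction to nested disjunction\<close>

definition nd_to_no_insert :: "form list \<Rightarrow> line \<Rightarrow> line \<Rightarrow> line list" where
  "nd_to_no_insert D = (\<lambda>(\<Delta>, C) (\<Gamma>, B).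
     if \<Delta> = \<Gamma> then []
     else if \<Delta> = butlast \<Gamma> then
       instance_lines \<Gamma> (last \<Gamma>) B D @ [(\<Gamma>, C), (\<Delta> @ [Neg (last \<Gamma>)], Neg (last \<Gamma>))] @
       instance_lines (\<Delta> @ [Neg (last \<Gamma>)]) (last \<Gamma>) B D @ [(\<Delta> @ [Neg (last \<Gamma>)], C)]
     else instance_lines \<Gamma> C C D)"

definition nd_to_no :: "form list \<Rightarrow> line list \<Rightarrow> line list" where
  "nd_to_no D = interleave (\<lambda>l _. l) (nd_to_no_insert D) initial_line"

lemma computable_nd_to_no_insert: "computable (\<lambda>p. nd_to_no_insert D (fst p) (snd p))"
  unfolding nd_to_no_insert_def case_prod_unfold
  by (intro computable_if_eq computable_append computable_instance_lines computable_Cons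
      computable_Pair computable_Neg computable_last computable_butlast computable_fst
      computable_snd computable_ident computable_const)

lemma length_nd_to_no_insert: "length (nd_to_no_insert D l p) \<le> 2 * length D + 3"
  by (simp add: nd_to_no_insert_def split: prod.split)

lemma nd_to_no_insert_same: "nd_to_no_insert D (\<Gamma>, B) (\<Gamma>, A) = []"
  by (simp add: nd_to_no_insert_def)

lemma append_neq_butlast: "xs @ [x] \<noteq> butlast xs"
  by (auto dest: arg_cong[of _ _ length])

lemma nd_to_no_insert_assume:
  "nd_to_no_insert D (\<Gamma> @ [A], A) (\<Gamma>, B) = instance_lines \<Gamma> A A D"
  by (simp add: nd_to_no_insert_def append_neq_butlast)

lemma nd_to_no_insert_deduction:
  "nd_to_no_insert D (\<Gamma>, C) (\<Gamma> @ [A], B) =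
     instance_lines (\<Gamma> @ [A]) A B D @ [(\<Gamma> @ [A], C), (\<Gamma> @ [Neg A], Neg A)] @
     instance_lines (\<Gamma> @ [Neg A]) A B D @ [(\<Gamma> @ [Neg A], C)]"
  by (simp add: nd_to_no_insert_def)

lemma nd_to_no_snoc:
  "nd_to_no D (P @ [l]) =
     nd_to_no D P @ nd_to_no_insert D l (current_ctx P, snd (last P)) @ [l]"
  by (simp add: nd_to_no_def interleave_snoc fold_initial_line)

lemma last_nd_to_no: "last (nd_to_no D P) = last P"
  by (simp add: nd_to_no_def last_interleave)

lemma nd_to_no_eq_Nil_iff: "nd_to_no D P = [] \<longleftrightarrow> P = []"
  by (simp add: nd_to_no_def interleave_eq_Nil_iff)

definition case_split_tautologies :: "form set" where
  "case_split_tautologies = {Or (Var 0) (Neg (Var 0)), Imp (Var 1) (Imp (Var 0) (Var 1)),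
     Imp (Neg (Var 0)) (Imp (Var 0) (Var 1))}"

lemma tautology_case_split: "A \<in> case_split_tautologies \<Longrightarrow> tautology A"
  by (auto simp: case_split_tautologies_def tautology_def)

lemma instances_case_split:
  assumes "case_split_tautologies \<subseteq> set D"
  shows "{Or A (Neg A), Imp B (Imp A B), Imp (Neg A) (Imp A B)}
    \<subseteq> set (map (subst (pair_subst A B)) D)"
proof -
  have "{Or A (Neg A), Imp B (Imp A B), Imp (Neg A) (Imp A B)}
      = subst (pair_subst A B) ` case_split_tautologies"
    by (simp add: case_split_tautologies_def pair_subst_def)
  with image_mono[OF assms] show ?thesis by simp
qed

lemma no_state_last_available:
  "no_state F P K H \<Longrightarrow> P \<noteq> [] \<Longrightarrow> snd (last P) \<in> H"
  by (induction rule: no_state.induct) simp_all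

lemma no_state_case_split:
  assumes D: "derivation F {} D" "case_split_tautologies \<subseteq> set D"
    and state: "no_state F P (First_branch A G # K) H"
    and last: "last P = (branches_ctx K @ [A], B)" and em: "Or A (Neg A) \<in> G"
  shows "no_state F
    (P @ instance_lines (branches_ctx K @ [A]) A B D @
      [(branches_ctx K @ [A], Imp A B), (branches_ctx K @ [Neg A], Neg A)] @
      instance_lines (branches_ctx K @ [Neg A]) A B D @
      [(branches_ctx K @ [Neg A], Imp A B), (branches_ctx K, Imp A B)])
    K (insert (Imp A B) G)"
proof -
  let ?H = "\<lambda>H. insert (Imp A B) (H \<union> set (map (subst (pair_subst A B)) D))"
  have D': "{Or A (Neg A), Imp B (Imp A B), Imp (Neg A) (Imp A B)} \<subseteq> ?H H'" for H'
    using instances_case_split[OF D(2), of A B] by auto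
  let ?P = "P @ instance_lines (branches_ctx K @ [A]) A B D @ [(branches_ctx K @ [A], Imp A B)]"
  have "P \<noteq> []" using no_state_current_ctx[OF state] by auto
  with last have "B \<in> H" using no_state_last_available[OF state] by simp
  then have "no_state F ?P (First_branch A G # K) (?H H)"
    using no_state_mp[OF no_state_instance_lines[OF state D(1)], of B A B "Imp A B"] D'[of H]
    by simp
  then have "no_state F (?P @ [(branches_ctx K @ [Neg A], Neg A)])
      (Second_branch A (Imp A B) (Neg A) G # K) (insert (Neg A) G)"
    by (rule no_state_assume_second) simp
  from no_state_mp[OF no_state_instance_lines[OF this D(1)], of "Neg A" A B "Imp A B"]
  have "no_state F (?P @ [(branches_ctx K @ [Neg A], Neg A)] @
      instance_lines (branches_ctx K @ [Neg A]) A B D @ [(branches_ctx K @ [Neg A], Imp A B)])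
      (Second_branch A (Imp A B) (Neg A) G # K) (?H (insert (Neg A) G))"
    using D'[of G] by simp
  from no_state_or_elim[OF this em] show ?thesis by simp
qed

fun case_split_branch :: "frame \<Rightarrow> branch \<Rightarrow> bool" where
  "case_split_branch (A, G) b \<longleftrightarrow>
     (\<exists>G'. b = First_branch A G' \<and> G \<subseteq> G' \<and> Or A (Neg A) \<in> G')"

lemma case_split_branches_ctx:
  "list_all2 case_split_branch K K' \<Longrightarrow> branches_ctx K' = frames_ctx K"
  by (induction rule: list_all2_induct) auto

definition no_covers :: "form set \<Rightarrow> line list \<Rightarrow> frame list \<Rightarrow> form set \<Rightarrow> bool" where
  "no_covers F Q K H \<longleftrightarrow>
     (\<exists>K' H'. no_state F Q K' H' \<and> H \<subseteq> H' \<and> list_all2 case_split_branch K K')"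

lemma no_coversI:
  "no_state F Q K' H' \<Longrightarrow> H \<subseteq> H' \<Longrightarrow> list_all2 case_split_branch K K' \<Longrightarrow> no_covers F Q K H"
  unfolding no_covers_def by blast

lemma no_coversE:
  assumes "no_covers F Q K H"
  obtains K' H' where "no_state F Q K' H'" "H \<subseteq> H'" "list_all2 case_split_branch K K'"
    "branches_ctx K' = frames_ctx K"
  using assms case_split_branches_ctx unfolding no_covers_def by blast

lemma no_covers_axiom:
  assumes "no_covers F Q K H" "axiom_instance F A"
  shows "no_covers F (Q @ [(frames_ctx K, A)]) K (insert A H)"
proof -
  obtain K' H' where Q: "no_state F Q K' H'" "H \<subseteq> H'" "list_all2 case_split_branch K K'"
    and ctx: "branches_ctx K' = frames_ctx K"
    using assms(1) by (rule no_coversE)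
  have "no_state F (Q @ [(frames_ctx K, A)]) K' (insert A H')"
    using no_state_axiom[OF Q(1) assms(2)] by (simp add: ctx)
  then show ?thesis using Q(2,3) by (auto intro: no_coversI)
qed

lemma no_covers_mp:
  assumes "no_covers F Q K H" "A \<in> H" "Imp A B \<in> H"
  shows "no_covers F (Q @ [(frames_ctx K, B)]) K (insert B H)"
proof -
  obtain K' H' where Q: "no_state F Q K' H'" "H \<subseteq> H'" "list_all2 case_split_branch K K'"
    and ctx: "branches_ctx K' = frames_ctx K"
    using assms(1) by (rule no_coversE)
  have "no_state F (Q @ [(frames_ctx K, B)]) K' (insert B H')"
    using no_state_mp[OF Q(1), of A B] Q(2) assms(2,3) by (auto simp: ctx)
  then show ?thesis using Q(2,3) by (auto intro: no_coversI)
qed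

lemma no_covers_assume:
  assumes D: "derivation F {} D" "case_split_tautologies \<subseteq> set D" and "no_covers F Q K H"
  shows "no_covers F (Q @ instance_lines (frames_ctx K) A A D @ [(frames_ctx K @ [A], A)])
    ((A, H) # K) (insert A H)"
proof -
  obtain K' H' where Q: "no_state F Q K' H'" "H \<subseteq> H'" "list_all2 case_split_branch K K'"
    and ctx: "branches_ctx K' = frames_ctx K"
    using assms(3) by (rule no_coversE)
  let ?H = "H' \<union> set (map (subst (pair_subst A A)) D)"
  have "no_state F (Q @ instance_lines (frames_ctx K) A A D @ [(frames_ctx K @ [A], A)])
      (First_branch A ?H # K') (insert A ?H)"
    using no_state_assume[OF no_state_instance_lines[OF Q(1) D(1)]] by (simp add: ctx)
  moreover have "case_split_branch (A, H) (First_branch A ?H)"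
    using Q(2) instances_case_split[OF D(2), of A A] by auto
  ultimately show ?thesis using Q(2,3) by (intro no_coversI) auto
qed

lemma no_covers_deduction:
  assumes D: "derivation F {} D" "case_split_tautologies \<subseteq> set D"
    and covers: "no_covers F Q ((A, G) # K) H" and last: "last Q = (frames_ctx K @ [A], B)"
  shows "no_covers F
    (Q @ instance_lines (frames_ctx K @ [A]) A B D @
      [(frames_ctx K @ [A], Imp A B), (frames_ctx K @ [Neg A], Neg A)] @
      instance_lines (frames_ctx K @ [Neg A]) A B D @
      [(frames_ctx K @ [Neg A], Imp A B), (frames_ctx K, Imp A B)])
    K (insert (Imp A B) G)"
proof -
  obtain G' K' H' where Q: "no_state F Q (First_branch A G' # K') H'" "G \<subseteq> G'"
    and em: "Or A (Neg A) \<in> G'" and K': "list_all2 case_split_branch K K'"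
    using covers by (auto simp: no_covers_def list_all2_Cons1)
  note ctx = case_split_branches_ctx[OF K']
  have "insert (Imp A B) G \<subseteq> insert (Imp A B) G'" using Q(2) by auto
  with no_state_case_split[OF D Q(1) last[folded ctx] em] show ?thesis
    unfolding ctx by (intro no_coversI[OF _ _ K'])
qed

lemma no_covers_nd_to_no:
  assumes D: "derivation F {} D" "case_split_tautologies \<subseteq> set D"
    and "nd_state F P K H"
  shows "no_covers F (nd_to_no D P) K H"
  using assms(3)
proof (induction rule: nd_state.induct)
  case nd_state_empty
  have "no_state F (nd_to_no D []) [] {}" by (simp add: nd_to_no_def no_state_empty)
  then show ?case by (rule no_coversI) simp_all
next
  case (nd_state_axiom P K H A)
  then show ?case
    using no_covers_axiom[OF nd_state_axiom(3,2)]
    by (simp add: nd_to_no_snoc nd_to_no_insert_same nd_state_current_ctx)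
next
  case (nd_state_assume P K H A)
  then show ?case
    using no_covers_assume[OF D nd_state_assume(2)]
    by (simp add: nd_to_no_snoc nd_to_no_insert_assume nd_state_current_ctx)
next
  case (nd_state_mp P K H A B)
  then show ?case
    using no_covers_mp[OF nd_state_mp(4,2,3)]
    by (simp add: nd_to_no_snoc nd_to_no_insert_same nd_state_current_ctx)
next
  case (nd_state_deduction P A G K H B)
  then show ?case
    using no_covers_deduction[OF D nd_state_deduction(3), of B]
    by (simp add: nd_to_no_snoc nd_to_no_insert_deduction nd_state_current_ctx last_nd_to_no)
qed

lemma no_linearly_simulates_nd:
  assumes "classical_frege_system F"
  shows "linearly_simulates (no_proof F) (nd_proof F)"
proof -
  have "finite case_split_tautologies" by (simp add: case_split_tautologies_def)
  then obtain D where D: "derivation F {} D" "case_split_tautologies \<subseteq> set D"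
    using classical_frege_system_derivation[OF assms] tautology_case_split by blast
  have "no_proof F (nd_to_no D P) A" if "nd_proof F P A" for P A
    using that no_covers_nd_to_no[OF D]
    unfolding nd_proof_iff no_proof_iff last_nd_to_no nd_to_no_eq_Nil_iff no_covers_def by blast
  moreover have "computable (\<lambda>p::line \<times> line. fst p)"
    by (rule computable_fst[OF computable_ident])
  ultimately show ?thesis
    unfolding nd_to_no_def
    using computable_nd_to_no_insert length_nd_to_no_insert
    by (intro linearly_simulates_interleave)
qed

section \<open>From nested disjunction to nested deduction\<close>

text \<open>The lines that close a pair of blocks show its second assumption only, so the first
  assumptions are kept on a stack.\<close>

definition update_assumptions :: "line \<Rightarrow> form list \<times> line \<Rightarrow> form list \<times> line" where
  "update_assumptions = (\<lambda>(\<Delta>, C) (L, \<Gamma>, B).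
     (if \<Delta> = \<Gamma> then L
      else if \<Delta> = butlast \<Gamma> then tl L
      else if butlast \<Delta> = \<Gamma> then C # L
      else L, \<Delta>, C))"

text \<open>A second assumption \<open>A\<close> equal to the first one cannot be told from a repetition of \<open>A\<close> inside
  the first block, but it need not be: \<open>A\<close> is then derived again from \<open>A \<supset> A\<close> and the block is
  kept open, and closing it yields both premises of the disjunction elimination at once.
  For this reason every line that leaves the context unchanged is preceded by an instance of \<open>D\<close>,
  a derivation of \<open>p \<supset> p\<close>.\<close>

definition no_to_nd_insert :: "form list \<Rightarrow> line \<Rightarrow> form list \<times> line \<Rightarrow> line list" where
  "no_to_nd_insert D = (\<lambda>(\<Delta>, C) (L, \<Gamma>, B).
     if \<Delta> = \<Gamma> then instance_lines \<Gamma> C C D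
     else if \<Delta> = butlast \<Gamma> then
       (\<Delta>, Imp (last \<Gamma>) C) # map (Pair \<Delta>) (or_elim_steps (hd L) (last \<Gamma>) C)
     else if butlast \<Delta> = \<Gamma> then []
     else [(butlast \<Delta>, Imp (last \<Gamma>) B)])"

definition no_to_nd :: "form list \<Rightarrow> line list \<Rightarrow> line list" where
  "no_to_nd D = interleave update_assumptions (no_to_nd_insert D) ([], initial_line)"

lemma computable_update_assumptions: "computable (\<lambda>p. update_assumptions (fst p) (snd p))"
  unfolding update_assumptions_def case_prod_unfold
  by (intro computable_if_eq computable_Pair computable_Cons computable_tl computable_butlast
      computable_fst computable_snd computable_ident)

lemma computable_no_to_nd_insert: "computable (\<lambda>p. no_to_nd_insert D (fst p) (snd p))"
  unfolding no_to_nd_insert_def or_elim_steps_def or_elim_schema_def list.map case_prod_unfold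
  by (intro computable_if_eq computable_instance_lines computable_Cons computable_Pair
      computable_Imp computable_Or computable_hd computable_last computable_butlast
      computable_fst computable_snd computable_ident computable_const)

lemma length_no_to_nd_insert: "length (no_to_nd_insert D l s) \<le> length D + 4"
  by (simp add: no_to_nd_insert_def or_elim_steps_def split: prod.split)

lemma no_to_nd_insert_same:
  "no_to_nd_insert D (\<Gamma>, A) (L, \<Gamma>, B) = instance_lines \<Gamma> A A D"
  by (simp add: no_to_nd_insert_def)

lemma no_to_nd_insert_assume: "no_to_nd_insert D (\<Gamma> @ [A], A) (L, \<Gamma>, B) = []"
  by (simp add: no_to_nd_insert_def append_neq_butlast)

lemma no_to_nd_insert_assume_second:
  "A \<noteq> B \<Longrightarrow> no_to_nd_insert D (\<Gamma> @ [B], B) (L, \<Gamma> @ [A], C) = [(\<Gamma>, Imp A C)]"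
  by (simp add: no_to_nd_insert_def)

lemma no_to_nd_insert_or_elim:
  "no_to_nd_insert D (\<Gamma>, C) (A # L, \<Gamma> @ [B], C') =
     (\<Gamma>, Imp B C) # map (Pair \<Gamma>) (or_elim_steps A B C)"
  by (simp add: no_to_nd_insert_def)

lemma fold_update_assumptions:
  "no_state F P K H \<Longrightarrow> fold update_assumptions P ([], initial_line) =
     (map first_assumption K, branches_ctx K, snd (last P))"
proof (induction rule: no_state.induct)
  case no_state_empty
  show ?case by (simp add: initial_line_def)
qed (simp_all add: update_assumptions_def append_neq_butlast)

lemma no_to_nd_snoc:
  assumes "no_state F P K H"
  shows "no_to_nd D (P @ [l]) = no_to_nd D P @
    no_to_nd_insert D l (map first_assumption K, branches_ctx K, snd (last P)) @ [l]"
  by (simp add: no_to_nd_def interleave_snoc fold_update_assumptions[OF assms])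

lemma last_no_to_nd: "last (no_to_nd D P) = last P"
  by (simp add: no_to_nd_def last_interleave)

lemma no_to_nd_eq_Nil_iff: "no_to_nd D P = [] \<longleftrightarrow> P = []"
  by (simp add: no_to_nd_def interleave_eq_Nil_iff)

fun nested_frames :: "form set \<Rightarrow> frame list \<Rightarrow> bool" where
  "nested_frames H [] \<longleftrightarrow> True"
| "nested_frames H ((A, G) # K) \<longleftrightarrow> insert A G \<subseteq> H \<and> nested_frames G K"

lemma nested_frames_insert: "nested_frames H K \<Longrightarrow> nested_frames (insert A H) K"
  by (induction H K rule: nested_frames.induct) auto

lemma nd_state_nested_frames: "nd_state F P K H \<Longrightarrow> nested_frames H K"
  by (induction rule: nd_state.induct) (auto intro: nested_frames_insert)

lemma nd_state_or_elim:
  assumes "nd_state F P ((B, G) # K) H" "last P = (frames_ctx K @ [B], C)"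
    and "Or A B \<in> G" "A = B \<or> Imp A C \<in> G" "axiom_instance F (or_elim_schema A B C)"
  shows "\<exists>H'. insert C G \<subseteq> H' \<and> nd_state F
    (P @ (frames_ctx K, Imp B C) # map (Pair (frames_ctx K)) (or_elim_steps A B C) @
      [(frames_ctx K, C)]) K H'"
proof -
  let ?G = "insert (Imp B C) G" and ?D = "or_elim_steps A B C @ [C]"
  have "derivation F ?G ?D"
    using assms(3-5) by (intro derivation_or_elim_steps) auto
  from nd_state_derivation[OF nd_state_deduction[OF assms(1,2)] this]
  have "nd_state F (P @ (frames_ctx K, Imp B C) # map (Pair (frames_ctx K)) ?D) K
      (?G \<union> set ?D)" by simp
  then show ?thesis by (intro exI[of _ "?G \<union> set ?D"]) auto
qed

fun discharging_frame :: "branch \<Rightarrow> frame \<Rightarrow> bool" where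
  "discharging_frame (First_branch A G) f \<longleftrightarrow> fst f = A \<and> G \<subseteq> snd f"
| "discharging_frame (Second_branch A C B G) f \<longleftrightarrow>
     fst f = B \<and> G \<subseteq> snd f \<and> (A = B \<or> Imp A C \<in> snd f)"

lemma discharging_frames_ctx:
  "list_all2 discharging_frame K K' \<Longrightarrow> frames_ctx K' = branches_ctx K"
proof (induction rule: list_all2_induct)
  case (Cons b K f K')
  then show ?case by (cases b) auto
qed simp

lemma instance_self_implication:
  assumes "Imp (Var 0) (Var 0) \<in> set D"
  shows "Imp A A \<in> set (map (subst (pair_subst A A)) D)"
proof -
  have "Imp A A = subst (pair_subst A A) (Imp (Var 0) (Var 0))" by (simp add: pair_subst_def)
  with imageI[OF assms, of "subst (pair_subst A A)"] show ?thesis by simp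
qed

definition nd_covers :: "form set \<Rightarrow> line list \<Rightarrow> branch list \<Rightarrow> form set \<Rightarrow> bool" where
  "nd_covers F Q K H \<longleftrightarrow>
     (\<exists>K' H'. nd_state F Q K' H' \<and> H \<subseteq> H' \<and> list_all2 discharging_frame K K')"

lemma nd_coversI:
  "nd_state F Q K' H' \<Longrightarrow> H \<subseteq> H' \<Longrightarrow> list_all2 discharging_frame K K' \<Longrightarrow> nd_covers F Q K H"
  unfolding nd_covers_def by blast

lemma nd_coversE:
  assumes "nd_covers F Q K H"
  obtains K' H' where "nd_state F Q K' H'" "H \<subseteq> H'" "list_all2 discharging_frame K K'"
    "frames_ctx K' = branches_ctx K"
  using assms discharging_frames_ctx unfolding nd_covers_def by blast

lemma nd_covers_axiom:
  assumes "nd_covers F Q K H" "derivation F {} D" "axiom_instance F A"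
  shows "nd_covers F (Q @ instance_lines (branches_ctx K) A A D @ [(branches_ctx K, A)]) K
    (insert A H)"
proof -
  obtain K' H' where Q: "nd_state F Q K' H'" "H \<subseteq> H'" "list_all2 discharging_frame K K'"
    and ctx: "frames_ctx K' = branches_ctx K"
    using assms(1) by (rule nd_coversE)
  from nd_state_axiom[OF nd_state_instance_lines[OF Q(1) assms(2)] assms(3)]
  show ?thesis using Q(2,3) by (intro nd_coversI) (auto simp: ctx)
qed

lemma nd_covers_mp:
  assumes "nd_covers F Q K H" "derivation F {} D" "A \<in> H" "Imp A B \<in> H"
  shows "nd_covers F (Q @ instance_lines (branches_ctx K) B B D @ [(branches_ctx K, B)]) K
    (insert B H)"
proof -
  obtain K' H' where Q: "nd_state F Q K' H'" "H \<subseteq> H'" "list_all2 discharging_frame K K'"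
    and ctx: "frames_ctx K' = branches_ctx K"
    using assms(1) by (rule nd_coversE)
  have "A \<in> H'" "Imp A B \<in> H'" using Q(2) assms(3,4) by auto
  with nd_state_mp[OF nd_state_instance_lines[OF Q(1) assms(2)], of A B B B]
  show ?thesis using Q(2,3) by (intro nd_coversI) (auto simp: ctx)
qed

lemma nd_covers_assume:
  assumes "nd_covers F Q K H"
  shows "nd_covers F (Q @ [(branches_ctx K @ [A], A)]) (First_branch A H # K) (insert A H)"
proof -
  obtain K' H' where Q: "nd_state F Q K' H'" "H \<subseteq> H'" "list_all2 discharging_frame K K'"
    and ctx: "frames_ctx K' = branches_ctx K"
    using assms by (rule nd_coversE)
  from nd_state_assume[OF Q(1), of A] Q(2,3) show ?thesis
    by (intro nd_coversI[of _ _ "(A, H') # K'" "insert A H'"]) (auto simp: ctx)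
qed

lemma nd_covers_FirstE:
  assumes "nd_covers F Q (First_branch A G # K) H"
  obtains G' K' H' where "nd_state F Q ((A, G') # K') H'" "G \<subseteq> G'"
    "list_all2 discharging_frame K K'" "frames_ctx K' = branches_ctx K"
  using assms discharging_frames_ctx by (auto simp: nd_covers_def list_all2_Cons1)

lemma nd_covers_assume_again:
  assumes "nd_covers F Q (First_branch A G # K) H"
    and D: "derivation F {} D" "Imp (Var 0) (Var 0) \<in> set D"
  shows "nd_covers F
    (Q @ instance_lines (branches_ctx K @ [A]) A A D @ [(branches_ctx K @ [A], A)])
    (Second_branch A C A G # K) (insert A G)"
proof -
  obtain G' K' H' where Q: "nd_state F Q ((A, G') # K') H'" "G \<subseteq> G'"
      "list_all2 discharging_frame K K'"
    and ctx: "frames_ctx K' = branches_ctx K"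
    using assms(1) by (rule nd_covers_FirstE)
  have "A \<in> H'" "G' \<subseteq> H'" using nd_state_nested_frames[OF Q(1)] by auto
  with nd_state_mp[OF nd_state_instance_lines[OF Q(1) D(1)], of A A A A]
    instance_self_implication[OF D(2), of A] Q(2,3)
  show ?thesis by (intro nd_coversI[of _ _ "(A, G') # K'"]) (auto simp: ctx)
qed

lemma nd_covers_assume_second:
  assumes "nd_covers F Q (First_branch A G # K) H" "last Q = (branches_ctx K @ [A], C)"
  shows "nd_covers F (Q @ [(branches_ctx K, Imp A C), (branches_ctx K @ [B], B)])
    (Second_branch A C B G # K) (insert B G)"
proof -
  obtain G' K' H' where Q: "nd_state F Q ((A, G') # K') H'" "G \<subseteq> G'"
      "list_all2 discharging_frame K K'"
    and ctx: "frames_ctx K' = branches_ctx K"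
    using assms(1) by (rule nd_covers_FirstE)
  from nd_state_assume[OF nd_state_deduction[OF Q(1) assms(2)[folded ctx]], of B] Q(2,3)
  show ?thesis by (intro nd_coversI[of _ _ "(B, insert (Imp A C) G') # K'"]) (auto simp: ctx)
qed

lemma nd_covers_insert_assume_second:
  assumes D: "derivation F {} D" "Imp (Var 0) (Var 0) \<in> set D"
    and covers: "nd_covers F Q (First_branch A G # K) H" and "last Q = (branches_ctx K @ [A], C)"
  shows "nd_covers F
    (Q @ no_to_nd_insert D (branches_ctx K @ [B], B) (L, branches_ctx K @ [A], C) @
      [(branches_ctx K @ [B], B)]) (Second_branch A C B G # K) (insert B G)"
proof (cases "A = B")
  case True
  then show ?thesis
    using nd_covers_assume_again[OF covers D] by (simp add: no_to_nd_insert_same)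
next
  case False
  then show ?thesis
    using nd_covers_assume_second[OF covers assms(4)] by (simp add: no_to_nd_insert_assume_second)
qed

lemma nd_covers_or_elim:
  assumes "nd_covers F Q (Second_branch A C B G # K) H" "Or A B \<in> G"
    and last: "last Q = (branches_ctx K @ [B], C)"
    and ax: "axiom_instance F (or_elim_schema A B C)"
  shows "nd_covers F
    (Q @ (branches_ctx K, Imp B C) # map (Pair (branches_ctx K)) (or_elim_steps A B C) @
      [(branches_ctx K, C)]) K (insert C G)"
proof -
  obtain G' K' H' where Q: "nd_state F Q ((B, G') # K') H'" "G \<subseteq> G'" "A = B \<or> Imp A C \<in> G'"
    and K': "list_all2 discharging_frame K K'"
    using assms(1) by (auto simp: nd_covers_def list_all2_Cons1)
  note ctx = discharging_frames_ctx[OF K']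
  have "Or A B \<in> G'" using assms(2) Q(2) by auto
  from nd_state_or_elim[OF Q(1) last[folded ctx] this Q(3) ax]
  show ?thesis
    using Q(2) unfolding ctx by (auto intro: nd_coversI[OF _ _ K'])
qed

lemma nd_covers_no_to_nd:
  assumes D: "derivation F {} D" "Imp (Var 0) (Var 0) \<in> set D"
    and or_elim: "\<And>A B C. axiom_instance F (or_elim_schema A B C)"
    and "no_state F P K H"
  shows "nd_covers F (no_to_nd D P) K H"
  using assms(4)
proof (induction rule: no_state.induct)
  case no_state_empty
  have "nd_state F (no_to_nd D []) [] {}" by (simp add: no_to_nd_def nd_state_empty)
  then show ?case by (rule nd_coversI) simp_all
next
  case (no_state_axiom P K H A)
  then show ?case
    using nd_covers_axiom[OF no_state_axiom(3) D(1) no_state_axiom(2)]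
    by (simp add: no_to_nd_snoc[OF no_state_axiom(1)] no_to_nd_insert_same)
next
  case (no_state_mp P K H A B)
  then show ?case
    using nd_covers_mp[OF no_state_mp(4) D(1) no_state_mp(2,3)]
    by (simp add: no_to_nd_snoc[OF no_state_mp(1)] no_to_nd_insert_same)
next
  case (no_state_assume P K H A)
  then show ?case
    using nd_covers_assume[OF no_state_assume(2)]
    by (simp add: no_to_nd_snoc[OF no_state_assume(1)] no_to_nd_insert_assume)
next
  case (no_state_assume_second P A G K H C B)
  then show ?case
    using nd_covers_insert_assume_second[OF D no_state_assume_second(3)]
    by (simp add: no_to_nd_snoc[OF no_state_assume_second(1)] last_no_to_nd)
next
  case (no_state_or_elim P A C B G K H)
  then show ?case
    using nd_covers_or_elim[OF no_state_or_elim(4,2) _ or_elim]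
    by (simp add: no_to_nd_snoc[OF no_state_or_elim(1)] no_to_nd_insert_or_elim last_no_to_nd)
qed

lemma nd_linearly_simulates_no:
  assumes "classical_frege_system F"
  shows "linearly_simulates (nd_proof F) (no_proof F)"
proof -
  have "tautology (Imp (Var 0) (Var 0))" by (simp add: tautology_def)
  then obtain D where D: "derivation F {} D" "Imp (Var 0) (Var 0) \<in> set D"
    using classical_frege_system_derivation[OF assms, of "{Imp (Var 0) (Var 0)}"] by auto
  have "nd_proof F (no_to_nd D P) A" if "no_proof F P A" for P A
    using that nd_covers_no_to_nd[OF D classical_frege_system_or_elim[OF assms]]
    unfolding nd_proof_iff no_proof_iff last_no_to_nd no_to_nd_eq_Nil_iff nd_covers_def by blast
  then show ?thesis
    unfolding no_to_nd_def
    using computable_update_assumptions computable_no_to_nd_insert length_no_to_nd_insert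
    by (intro linearly_simulates_interleave)
qed

theorem theorem6:
  fixes F :: "form set"
  assumes "classical_frege_system F"
  shows "linearly_simulates (no_proof F) (nd_proof F) \<and>
         linearly_simulates (nd_proof F) (no_proof F)"
  using no_linearly_simulates_nd[OF assms] nd_linearly_simulates_no[OF assms] ..

end
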